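(* Let $n$ be a positive integer and let $\kappa,\lambda,\mu,\nu$ be partitions of length at most $n$ such that $\mu\supseteq\nu$ and $m(\mu-\nu)\supseteq\lambda-\kappa$ for some positive integer $m$. Then, for all sufficiently large integers $r$, the sequence of skew Schur polynomials $\{s_{(\kappa+k\mu)/(\lambda+k\nu)}(x_1,\dots,x_n)\}_{k=r}^{\infty}$ satisfies a linear recurrence with a minimal characteristic polynomial of the form $$\chi_m(t)=\prod_{\mathbf{w}\in W}(t-\mathbf{x}^{\mathbf{w}}),$$ where $W\subset\mathbb{N}^n$ is invariant under permutations, i.e. $(w_1,\dots,w_n)\in W$ implies $(w_{\sigma(1)},\dots,w_{\sigma(n)})\in W$ for every permutation $\sigma\in\mathfrak{S}_n$.
   Context: A partition is a finite weakly decreasing sequence $\lambda=(\lambda_1,\lambda_2,\dots)$ of non-negative integers; its length is the number of positive entries, and $\lambda_i=0$ for $i$ larger than the length. Addition, subtraction and multiplication by scalars are elementwise. For integer vectors (in particular partitions) $\alpha\supseteq\beta$ means $\alpha_i\ge\beta_i$ for all $i$. $\mathbb{N}$ includes $0$. For partitions $\lambda\supseteq\mu$, the skew Young diagram of shape $\lambda/\mu$ is the set of boxes $\{(i,j)\in\mathbb{Z}^2 : \mu_i<j\le\lambda_i\}$ ($i$ is the row, $j$ the column, both $\geq 1$). A semi-standard Young tableau (SSYT) of shape $\lambda/\mu$ with entries in $\{1,\dots,n\}$ is a filling of these boxes with elements of $\{1,\dots,n\}$ that is weakly increasing along rows (left to right) and strictly increasing down columns. The set of these is $\mathbf{T}^n_{\lambda/\mu}$.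 The weight of $T$ is $w(T)=(t_1,\dots,t_n)$, where $t_k$ is the number of boxes of $T$ containing $k$. For $\mathbf{x}=(x_1,\dots,x_n)$ and $\alpha\in\mathbb{N}^n$, $\mathbf{x}^{\alpha}=x_1^{\alpha_1}\cdots x_n^{\alpha_n}$. The skew Schur polynomial is $s_{\lambda/\mu}(\mathbf{x})=\sum_{T\in\mathbf{T}^n_{\lambda/\mu}}\mathbf{x}^{w(T)}$. A sequence $\{a_k\}_{k=r}^\infty$ satisfies a linear recurrence with characteristic polynomial $\chi(t)=\sum_{i=0}^d c_it^i$ (monic of degree $d$, coefficients in the field of rational functions in $x_1,\dots,x_n$) if $\sum_{i=0}^d c_i a_{k+i}=0$ for all $k\ge r$. A minimal characteristic polynomial is one of least degree. *)

theory Defs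
  imports
    "HOL-Library.FuncSet"
    "HOL-Library.Poly_Mapping"
    "HOL-Combinatorics.Permutations"
    "HOL-Computational_Algebra.Polynomial_Factorial"
begin

text \<open>
  A partition is a function on row numbers. Rows are numbered from 0, so \<open>p i\<close> is the
  part usually written with index \<open>i + 1\<close>. Columns, tableau entries and variables are
  numbered from 1.
\<close>

definition is_partition :: "(nat \<Rightarrow> nat) \<Rightarrow> bool" where
  "is_partition p \<longleftrightarrow> antimono p \<and> finite {i. p i > 0}"

definition partition_length :: "(nat \<Rightarrow> nat) \<Rightarrow> nat" where
  "partition_length p = card {i. p i > 0}"

definition skew_diagram :: "(nat \<Rightarrow> nat) \<Rightarrow> (nat \<Rightarrow> nat) \<Rightarrow> (nat \<times> nat) set" where
  "skew_diagram p q = {(i, j). q i < j \<and> j \<le> p i}"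

definition SSYT :: "nat \<Rightarrow> (nat \<Rightarrow> nat) \<Rightarrow> (nat \<Rightarrow> nat) \<Rightarrow> (nat \<times> nat \<Rightarrow> nat) set" where
  "SSYT n p q = {T \<in> skew_diagram p q \<rightarrow>\<^sub>E {1..n}.
     (\<forall>i j j'. (i, j) \<in> skew_diagram p q \<and> (i, j') \<in> skew_diagram p q \<and> j \<le> j'
        \<longrightarrow> T (i, j) \<le> T (i, j')) \<and>
     (\<forall>i i' j. (i, j) \<in> skew_diagram p q \<and> (i', j) \<in> skew_diagram p q \<and> i < i'
        \<longrightarrow> T (i, j) < T (i', j))}"

text \<open>
  Vectors of \<open>n\<close> natural numbers are extensional functions on \<open>{1..n}\<close>, so that distinct
  functions in this set are distinct vectors.
\<close>

abbreviation nat_vectors :: "nat \<Rightarrow> (nat \<Rightarrow> nat) set" where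
  "nat_vectors n \<equiv> {1..n} \<rightarrow>\<^sub>E UNIV"

definition weight :: "nat \<Rightarrow> (nat \<Rightarrow> nat) \<Rightarrow> (nat \<Rightarrow> nat) \<Rightarrow> (nat \<times> nat \<Rightarrow> nat) \<Rightarrow> nat \<Rightarrow> nat" where
  "weight n p q T = (\<lambda>k\<in>{1..n}. card {b \<in> skew_diagram p q. T b = k})"

text \<open>
  Polynomials over \<open>'a\<close> in variables indexed by all natural numbers: finitely supported maps
  from monomials (finitely supported exponent maps) to coefficients.
\<close>

type_synonym 'a mpoly = "(nat \<Rightarrow>\<^sub>0 nat) \<Rightarrow>\<^sub>0 'a"

definition mvar :: "nat \<Rightarrow> 'a::comm_semiring_1 mpoly" where
  "mvar k = Poly_Mapping.single (Poly_Mapping.single k 1) 1"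

definition mono_pow :: "nat \<Rightarrow> (nat \<Rightarrow> nat) \<Rightarrow> 'a::comm_semiring_1 mpoly" where
  "mono_pow n w = (\<Prod>k\<in>{1..n}. mvar k ^ w k)"

definition skew_schur :: "nat \<Rightarrow> (nat \<Rightarrow> nat) \<Rightarrow> (nat \<Rightarrow> nat) \<Rightarrow> 'a::comm_semiring_1 mpoly" where
  "skew_schur n p q = (\<Sum>T\<in>SSYT n p q. mono_pow n (weight n p q T))"

text \<open>The rational functions involving only the variables with index in \<open>{1..n}\<close>.\<close>

definition mpolys_in :: "nat \<Rightarrow> 'a::comm_semiring_1 mpoly set" where
  "mpolys_in n = {f. \<forall>e \<in> Poly_Mapping.keys f. Poly_Mapping.keys e \<subseteq> {1..n}}"

definition ratfuns_in :: "nat \<Rightarrow> 'a::field mpoly fract set" where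
  "ratfuns_in n = {Fract f g | f g. f \<in> mpolys_in n \<and> g \<in> mpolys_in n \<and> g \<noteq> 0}"

text \<open>
  \<open>char_poly_of K r a \<chi>\<close>: the sequence \<open>a r, a (r + 1), \<dots>\<close> satisfies a linear recurrence with
  monic characteristic polynomial \<open>\<chi>\<close> whose coefficients lie in the subfield \<open>K\<close>.
\<close>

definition char_poly_of :: "'b::field set \<Rightarrow> nat \<Rightarrow> (nat \<Rightarrow> 'b) \<Rightarrow> 'b poly \<Rightarrow> bool" where
  "char_poly_of K r a \<chi> \<longleftrightarrow>
     lead_coeff \<chi> = 1 \<and> (\<forall>i. coeff \<chi> i \<in> K) \<and>
     (\<forall>k\<ge>r. (\<Sum>i\<le>degree \<chi>. coeff \<chi> i * a (k + i)) = 0)"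

definition min_char_poly_of :: "'b::field set \<Rightarrow> nat \<Rightarrow> (nat \<Rightarrow> 'b) \<Rightarrow> 'b poly \<Rightarrow> bool" where
  "min_char_poly_of K r a \<chi> \<longleftrightarrow>
     char_poly_of K r a \<chi> \<and> (\<forall>\<psi>. char_poly_of K r a \<psi> \<longrightarrow> degree \<chi> \<le> degree \<psi>)"

end

theory Submission
  imports Defs "HOL-Computational_Algebra.Formal_Power_Series" "Jordan_Normal_Form.Determinant"
begin

text \<open>
  The key is the Jacobi-Trudi identity
  \<open>s\<^bsub>p/q\<^esub> = det (h\<^bsub>p i - q j - i + j\<^esub>)\<close>, whose size is the number \<open>n\<close> of rows and
  does not change when the shape is stretched. For \<open>p = \<kappa> + k \<mu>\<close> and \<open>q = \<rho> + k \<nu>\<close> the entry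
  in row \<open>i\<close> and column \<open>j\<close> is \<open>h\<^bsub>k a + b\<^esub>\<close> with \<open>a = \<mu> i - \<nu> j\<close>. If \<open>a < 0\<close> it is
  eventually zero, if \<open>a = 0\<close> it is constant, and if \<open>a > 0\<close> the partial fraction
  decomposition of the generating function of the \<open>h\<^sub>m\<close> shows that it is eventually a
  combination of the powers \<open>x\<^sub>1\<^sup>k\<^sup>a, \<dots>, x\<^sub>n\<^sup>k\<^sup>a\<close> with rational coefficients that
  do not depend on \<open>k\<close> (\<open>complete_hom_exponential_sum\<close>, \<open>eventually_exp_sum_complete_hom\<close>).
  Sequences \<open>\<Sum>w. C\<^sub>w (x\<^sup>w)\<^sup>k\<close> with constant \<open>C\<^sub>w\<close> are closed under sums and products, so
  the determinant is one of them. No powers of \<open>k\<close> appear among the coefficients, and this is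
  why the roots of the characteristic polynomial are simple although many tableaux can share
  a weight.

  Let \<open>W\<close> be the set of the exponents with \<open>C\<^sub>w \<noteq> 0\<close>. Distinct monomials have linearly
  independent sequences of powers (\<open>exp_independent\<close>). Hence a monic polynomial is a characteristic
  polynomial of the sequence if and only if it vanishes at all \<open>x\<^sup>w\<close> with \<open>w \<in> W\<close>, and the product
  of the linear factors is the monic one of least degree (\<open>min_char_poly_of_exp_sum\<close>).
  Moreover, skew Schur polynomials are symmetric, so that permuting the variables permutes the
  terms of the exponential sum, and uniqueness of the coefficients gives the invariance of \<open>W\<close>
  (\<open>exponents_permutation_invariant\<close>).

  The Jacobi-Trudi identity itself (\<open>jacobi_trudi_eq_tableau_sum\<close>) is proved by induction on the
  number of variables: removing the boxes with the largest entry from a tableau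
  (\<open>tableau_sum_Suc\<close>) and one round of row operations on the determinant (\<open>jacobi_trudi_Suc\<close>)
  lead to the same sum over horizontal strips.
\<close>

section \<open>Complete homogeneous symmetric polynomials\<close>

text \<open>
  The factors of the generating function
  \<open>\<Sum>m. h\<^sub>m t\<^sup>m = (\<Prod>i. 1 / (1 - x\<^sub>i t))\<close>. As a product over the variables it makes the
  symmetry of \<open>h\<^sub>m\<close> evident, and splitting off one factor gives the recursion in the number of
  variables. The explicit series avoids inverses, so that any commutative ring will do.
\<close>

definition geometric_fps :: "'b::comm_ring_1 \<Rightarrow> 'b fps" where
  "geometric_fps c = Abs_fps (\<lambda>m. c ^ m)"

text \<open>
  The index is an integer because the entries of the Jacobi-Trudi matrix may have a negative
  index, and these entries must vanish.
\<close>

definition complete_hom :: "(nat \<Rightarrow> 'b::comm_ring_1) \<Rightarrow> nat \<Rightarrow> int \<Rightarrow> 'b" where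
  "complete_hom x n m =
     (if m < 0 then 0 else fps_nth (\<Prod>i\<in>{1..n}. geometric_fps (x i)) (nat m))"

lemma complete_hom_neg: "m < 0 \<Longrightarrow> complete_hom x n m = 0"
  by (simp add: complete_hom_def)

lemma complete_hom_0: "complete_hom x 0 m = (if m = 0 then 1 else 0)"
  by (auto simp: complete_hom_def)

lemma complete_hom_permute:
  assumes "\<sigma> permutes {1..n}"
  shows "complete_hom (x \<circ> \<sigma>) n m = complete_hom x n m"
proof -
  have "(\<Prod>i\<in>{1..n}. geometric_fps ((x \<circ> \<sigma>) i)) = (\<Prod>i\<in>{1..n}. geometric_fps (x i))"
    using prod.permute[OF assms, of "\<lambda>i. geometric_fps (x i)"] by (simp add: o_def)
  then show ?thesis by (simp add: complete_hom_def)
qed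

lemma complete_hom_Suc_conv:
  "complete_hom x (Suc n) (int m) =
     (\<Sum>j\<le>m. complete_hom x n (int j) * x (Suc n) ^ (m - j))"
proof -
  have "(\<Prod>i\<in>{1..Suc n}. geometric_fps (x i))
      = (\<Prod>i\<in>{1..n}. geometric_fps (x i)) * geometric_fps (x (Suc n))"
    by (simp add: prod.atLeast_Suc_atMost[of 1 "Suc n"] mult.commute)
  then show ?thesis
    by (simp add: complete_hom_def fps_mult_nth geometric_fps_def atLeast0AtMost)
qed

lemma complete_hom_Suc_rec:
  "complete_hom x (Suc n) m = complete_hom x n m + x (Suc n) * complete_hom x (Suc n) (m - 1)"
proof (cases "m \<le> 0")
  case True
  then show ?thesis
    using complete_hom_Suc_conv[of x n 0] by (cases "m = 0") (simp_all add: complete_hom_neg)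
next
  case False
  define k where "k = nat (m - 1)"
  have m: "m = int (Suc k)" "m - 1 = int k" using False by (auto simp: k_def)
  have "(\<Sum>j\<le>Suc k. complete_hom x n (int j) * x (Suc n) ^ (Suc k - j)) =
    complete_hom x n (int (Suc k)) +
    x (Suc n) * (\<Sum>j\<le>k. complete_hom x n (int j) * x (Suc n) ^ (k - j))"
    by (simp add: sum_distrib_left Suc_diff_le mult_ac)
  then show ?thesis
    unfolding m(2) unfolding m(1) by (simp only: complete_hom_Suc_conv)
qed

text \<open>
  Iterating the recursion \<open>h\<^sub>m(x\<^sub>1, \<dots>, x\<^sub>n\<^sub>+\<^sub>1) = h\<^sub>m(x\<^sub>1, \<dots>, x\<^sub>n) + x\<^sub>n\<^sub>+\<^sub>1 h\<^sub>m\<^sub>-\<^sub>1(x\<^sub>1, \<dots>, x\<^sub>n\<^sub>+\<^sub>1)\<close>.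
  With \<open>d\<close> the distance of two consecutive shifted parts, this is the effect of one row operation
  on the Jacobi-Trudi matrix.
\<close>

lemma complete_hom_telescope:
  "complete_hom x (Suc n) m - x (Suc n) ^ d * complete_hom x (Suc n) (m - int d) =
     (\<Sum>e<d. x (Suc n) ^ e * complete_hom x n (m - int e))"
proof (induction d)
  case (Suc d)
  have "complete_hom x (Suc n) (m - int d) = complete_hom x n (m - int d)
      + x (Suc n) * complete_hom x (Suc n) (m - int (Suc d))"
    by (subst complete_hom_Suc_rec) (simp add: algebra_simps)
  then show ?case using Suc by (simp add: algebra_simps)
qed simp

section \<open>The Jacobi-Trudi determinant\<close>

text \<open>
  The shapes are confined to the first \<open>N\<close> rows, and \<open>n\<close> is the number of variables. For an
  antimonotone \<open>p\<close> the shifted parts \<open>p i - i\<close> are strictly decreasing.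
\<close>

definition jacobi_trudi ::
    "(nat \<Rightarrow> 'b::comm_ring_1) \<Rightarrow> nat \<Rightarrow> nat \<Rightarrow> (nat \<Rightarrow> nat) \<Rightarrow> (nat \<Rightarrow> nat) \<Rightarrow> 'b" where
  "jacobi_trudi x n N p q =
     det (mat N N (\<lambda>(i, j). complete_hom x n ((int (p i) - int i) - (int (q j) - int j))))"

lemma jacobi_trudi_Leibniz:
  "jacobi_trudi x n N p q = (\<Sum>\<pi>\<in>{\<pi>. \<pi> permutes {0..<N}}. signof \<pi> *
     (\<Prod>i=0..<N. complete_hom x n ((int (p i) - int i) - (int (q (\<pi> i)) - int (\<pi> i)))))"
  unfolding jacobi_trudi_def
  by (subst det_def'[of _ N])
    (auto intro!: sum.cong prod.cong arg_cong2[of _ _ _ _ "(*)"] simp: permutes_in_image)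

lemma jacobi_trudi_permute:
  assumes "\<sigma> permutes {1..n}"
  shows "jacobi_trudi (x \<circ> \<sigma>) n N p q = jacobi_trudi x n N p q"
  using complete_hom_permute[OF assms, of x] by (simp add: jacobi_trudi_def)

lemma antimono_shift_le:
  assumes "antimono (p :: nat \<Rightarrow> nat)" "i \<le> j"
  shows "int (p j) - int j \<le> int (p i) - int i"
  using antimonoD[OF assms] assms(2) by simp

text \<open>
  If \<open>p i0 < q i0\<close>, all entries in rows from \<open>i0\<close> on and columns up to \<open>i0\<close> have a negative
  index. This block of zeros is too large for a permutation to avoid.
\<close>

lemma jacobi_trudi_not_contained:
  assumes p: "antimono p" and q: "antimono q" and i0: "i0 < N" "p i0 < q i0"
  shows "jacobi_trudi x n N p q = 0"
  unfolding jacobi_trudi_Leibniz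
proof (rule sum.neutral, safe)
  fix \<pi> assume \<pi>: "\<pi> permutes {0..<N}"
  have "\<exists>i\<in>{i0..<N}. \<pi> i \<le> i0"
  proof (rule ccontr)
    assume "\<not> ?thesis"
    then have "\<pi> ` {i0..<N} \<subseteq> {i0<..<N}"
      using permutes_in_image[OF \<pi>] by (fastforce simp: not_le)
    then have "card (\<pi> ` {i0..<N}) \<le> card {i0<..<N}"
      by (intro card_mono) auto
    then show False
      using i0 by (simp add: card_image[OF inj_on_subset[OF permutes_inj[OF \<pi>]]])
  qed
  then obtain i where i: "i0 \<le> i" "i < N" "\<pi> i \<le> i0" by auto
  have "(int (p i) - int i) - (int (q (\<pi> i)) - int (\<pi> i)) < 0"
    using antimono_shift_le[OF p i(1)] antimono_shift_le[OF q i(3)] i0 by linarith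
  then have "(\<Prod>i=0..<N. complete_hom x n ((int (p i) - int i) - (int (q (\<pi> i)) - int (\<pi> i)))) = 0"
    using i by (intro prod_zero) (auto intro!: bexI[of _ i] complete_hom_neg)
  then show "signof \<pi> * (\<Prod>i=0..<N. complete_hom x n ((int (p i) - int i) - (int (q (\<pi> i)) - int (\<pi> i)))) = 0"
    by simp
qed

lemma jacobi_trudi_0_same:
  assumes p: "antimono p"
  shows "jacobi_trudi x 0 N p p = 1"
proof -
  have "int (p i) - int i = int (p j) - int j \<longleftrightarrow> i = j" for i j
    using antimonoD[OF p, of i j] antimonoD[OF p, of j i] by (cases "i \<le> j") auto
  then have "mat N N (\<lambda>(i, j). complete_hom x 0 ((int (p i) - int i) - (int (p j) - int j))) = 1\<^sub>m N"
    by (intro eq_matI) (auto simp: complete_hom_0)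
  then show ?thesis by (simp add: jacobi_trudi_def)
qed

text \<open>
  Without variables, \<open>h\<^sub>m\<close> is the Kronecker delta of \<open>m\<close> and 0, so a nonzero term in the
  Leibniz expansion matches the shifted parts of \<open>p\<close> with those of \<open>q\<close>. Then \<open>p\<close> and
  \<open>q\<close> have the same sum, which is impossible if \<open>q\<close> is properly contained in \<open>p\<close>.
\<close>

lemma jacobi_trudi_0_distinct:
  assumes le: "\<And>i. q i \<le> p i" and i0: "i0 < N" "q i0 < p i0"
  shows "jacobi_trudi x 0 N p q = 0"
  unfolding jacobi_trudi_Leibniz
proof (rule sum.neutral, safe)
  fix \<pi> assume \<pi>: "\<pi> permutes {0..<N}"
  have "\<exists>i<N. (int (p i) - int i) - (int (q (\<pi> i)) - int (\<pi> i)) \<noteq> 0"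
  proof (rule ccontr)
    assume "\<not> ?thesis"
    then have "(\<Sum>i=0..<N. int (p i) - int i) = (\<Sum>i=0..<N. int (q (\<pi> i)) - int (\<pi> i))"
      by (intro sum.cong) auto
    also have "\<dots> = (\<Sum>i=0..<N. int (q i) - int i)"
      using sum.permute[OF \<pi>, of "\<lambda>i. int (q i) - int i"] by (simp add: o_def)
    finally have "(\<Sum>i=0..<N. int (p i)) = (\<Sum>i=0..<N. int (q i))"
      by (simp add: sum_subtractf)
    moreover have "(\<Sum>i=0..<N. int (q i)) < (\<Sum>i=0..<N. int (p i))"
      using le i0 by (intro sum_strict_mono_ex1) auto
    ultimately show False by simp
  qed
  then obtain i where i: "i < N" "(int (p i) - int i) - (int (q (\<pi> i)) - int (\<pi> i)) \<noteq> 0" by auto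
  have "(\<Prod>i=0..<N. complete_hom x 0 ((int (p i) - int i) - (int (q (\<pi> i)) - int (\<pi> i)))) = 0"
    using i by (intro prod_zero) (auto intro!: bexI[of _ i] simp: complete_hom_0)
  then show "signof \<pi> * (\<Prod>i=0..<N. complete_hom x 0 ((int (p i) - int i) - (int (q (\<pi> i)) - int (\<pi> i)))) = 0"
    by simp
qed

text \<open>
  The shapes \<open>\<nu>\<close> inside \<open>p\<close> for which the boxes of \<open>p/\<nu>\<close> lie in different columns. Such
  \<open>p/\<nu>\<close> are the possible sets of boxes for the largest entry of a tableau.
\<close>

definition horizontal_strips :: "nat \<Rightarrow> (nat \<Rightarrow> nat) \<Rightarrow> (nat \<Rightarrow> nat) set" where
  "horizontal_strips N p = {\<nu>. (\<forall>i<N. p (Suc i) \<le> \<nu> i \<and> \<nu> i \<le> p i) \<and> (\<forall>i\<ge>N. \<nu> i = 0)}"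

text \<open>
  From each row of the matrix in \<open>n + 1\<close> variables, subtract the next row times the power of the
  last variable that makes the sum in \<open>complete_hom_telescope\<close> stop exactly at \<open>p (i + 1)\<close>.
  Then row \<open>i\<close> becomes a sum of rows in \<open>n\<close> variables, indexed by \<open>v\<close> between \<open>p (i + 1)\<close> and
  \<open>p i\<close>, and multilinearity turns the determinant into a sum over all choices of these \<open>v\<close>, that
  is, over horizontal strips. The last row needs no partner, because row \<open>N\<close>, an empty row of
  \<open>p\<close>, would only contribute entries of negative index.
\<close>

lemma jacobi_trudi_Suc:
  assumes p: "antimono p" "p N = 0"
  shows "jacobi_trudi x (Suc n) N p q =
    (\<Sum>\<nu>\<in>horizontal_strips N p. x (Suc n) ^ (\<Sum>i<N. p i - \<nu> i) * jacobi_trudi x n N \<nu> q)"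
proof -
  let ?y = "x (Suc n)"
  let ?col = "\<lambda>j. int (q j) - int j"
  define A where "A = mat N N (\<lambda>(i, j). complete_hom x (Suc n) ((int (p i) - int i) - ?col j))"
  define d where "d i = Suc (p i - p (Suc i))" for i
  \<comment> \<open>Multiplication by \<open>L\<close> from the left performs all row operations at once.\<close>
  define L where "L = mat N N (\<lambda>(i, j). if j = i then 1 else if j = Suc i then - (?y ^ d i) else 0)"
  have A: "A \<in> carrier_mat N N" and L: "L \<in> carrier_mat N N" by (auto simp: A_def L_def)
  have p': "p (Suc i) \<le> p i" for i using p(1) by (simp add: antimono_iff_le_Suc)
  have LA: "(L * A) $$ (i, j) = (\<Sum>v=p (Suc i)..p i.
       ?y ^ (p i - v) * complete_hom x n ((int v - int i) - ?col j))" if ij: "i < N" "j < N" for i j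
  proof -
    have "(L * A) $$ (i, j) = (\<Sum>k=0..<N. L $$ (i, k) * A $$ (k, j))"
      using A L ij by (simp add: scalar_prod_def)
    also have "\<dots> = (\<Sum>k=0..<N. (if k = i then A $$ (i, j) else 0) +
        (if k = Suc i then - (?y ^ d i) * A $$ (k, j) else 0))"
      using ij by (intro sum.cong) (auto simp: L_def)
    also have "\<dots> = A $$ (i, j) +
        (if Suc i < N then - (?y ^ d i) * A $$ (Suc i, j) else 0)"
      using ij by (simp add: sum.distrib)
    also have "\<dots> = complete_hom x (Suc n) ((int (p i) - int i) - ?col j)
        - ?y ^ d i * complete_hom x (Suc n) ((int (p i) - int i) - ?col j - int (d i))"
    proof (cases "Suc i < N")
      case True
      have "(int (p i) - int i) - ?col j - int (d i) = (int (p (Suc i)) - int (Suc i)) - ?col j"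
        using p'[of i] by (simp add: d_def)
      then show ?thesis using True ij by (simp only:) (simp add: A_def)
    next
      case False
      then have "Suc i = N" using ij by simp
      then have "(int (p i) - int i) - ?col j - int (d i) < 0"
        using p(2) ij by (auto simp: d_def)
      then show ?thesis using False ij by (simp add: A_def complete_hom_neg)
    qed
    also have "\<dots> = (\<Sum>e<d i. ?y ^ e * complete_hom x n ((int (p i) - int i) - ?col j - int e))"
      by (rule complete_hom_telescope)
    also have "\<dots> = (\<Sum>v=p (Suc i)..p i. ?y ^ (p i - v) * complete_hom x n ((int v - int i) - ?col j))"
      using p'[of i]
      by (intro sum.reindex_bij_witness[of _ "\<lambda>v. p i - v" "\<lambda>e. p i - e"])
        (auto simp: d_def of_nat_diff algebra_simps)
    finally show ?thesis .
  qed
  have "upper_triangular L" by (auto simp: upper_triangular_def L_def)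
  then have "det L = 1"
    using det_upper_triangular[OF _ L] by (simp add: prod_list_diag_prod L_def)
  then have "jacobi_trudi x (Suc n) N p q = det (L * A)"
    by (simp add: jacobi_trudi_def A_def[symmetric] det_mult[OF L A])
  also have "\<dots> = (\<Sum>\<pi>\<in>{\<pi>. \<pi> permutes {0..<N}}. signof \<pi> * (\<Prod>i=0..<N. (L * A) $$ (i, \<pi> i)))"
    using L A by (intro det_def') auto
  also have "\<dots> = (\<Sum>\<pi>\<in>{\<pi>. \<pi> permutes {0..<N}}. signof \<pi> * (\<Prod>i=0..<N. \<Sum>v=p (Suc i)..p i.
       ?y ^ (p i - v) * complete_hom x n ((int v - int i) - ?col (\<pi> i))))"
    by (intro sum.cong prod.cong arg_cong2[of _ _ _ _ "(*)"] refl LA)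
      (auto simp: permutes_in_image)
  also have "\<dots> = (\<Sum>\<pi>\<in>{\<pi>. \<pi> permutes {0..<N}}. \<Sum>c\<in>(\<Pi>\<^sub>E i\<in>{0..<N}. {p (Suc i)..p i}).
      ?y ^ (\<Sum>i=0..<N. p i - c i) *
      (signof \<pi> * (\<Prod>i=0..<N. complete_hom x n ((int (c i) - int i) - ?col (\<pi> i)))))"
    by (simp add: prod_sum_PiE prod.distrib power_sum sum_distrib_left mult_ac)
  also have "\<dots> = (\<Sum>c\<in>(\<Pi>\<^sub>E i\<in>{0..<N}. {p (Suc i)..p i}).
      ?y ^ (\<Sum>i=0..<N. p i - c i) * jacobi_trudi x n N c q)"
    by (subst sum.swap) (simp add: jacobi_trudi_Leibniz sum_distrib_left)
  also have "\<dots> = (\<Sum>\<nu>\<in>horizontal_strips N p. ?y ^ (\<Sum>i<N. p i - \<nu> i) * jacobi_trudi x n N \<nu> q)"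
  proof (rule sum.reindex_bij_witness[of _ "\<lambda>\<nu>. restrict \<nu> {0..<N}" "\<lambda>c i. if i < N then c i else 0"])
    fix c assume "c \<in> (\<Pi>\<^sub>E i\<in>{0..<N}. {p (Suc i)..p i})"
    have "jacobi_trudi x n N (\<lambda>i. if i < N then c i else 0) q = jacobi_trudi x n N c q"
      by (simp add: jacobi_trudi_Leibniz)
    then show "?y ^ (\<Sum>i<N. p i - (if i < N then c i else 0)) *
        jacobi_trudi x n N (\<lambda>i. if i < N then c i else 0) q =
        ?y ^ (\<Sum>i=0..<N. p i - c i) * jacobi_trudi x n N c q"
      by (simp add: atLeast0LessThan)
  qed (auto simp: horizontal_strips_def PiE_iff extensional_def fun_eq_iff)
  finally show ?thesis .
qed

section \<open>Tableaux and the Jacobi-Trudi identity\<close>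

text \<open>
  The tableau sum for arbitrary ring elements in place of the variables. This allows
  permuting and renaming them.
\<close>

definition tableau_sum :: "(nat \<Rightarrow> 'b::comm_ring_1) \<Rightarrow> nat \<Rightarrow> (nat \<Rightarrow> nat) \<Rightarrow> (nat \<Rightarrow> nat) \<Rightarrow> 'b" where
  "tableau_sum x n p q = (\<Sum>T\<in>SSYT n p q. \<Prod>b\<in>skew_diagram p q. x (T b))"

lemma skew_diagram_eq_Sigma:
  assumes "\<And>i. i \<ge> N \<Longrightarrow> p i = 0"
  shows "skew_diagram p q = (SIGMA i:{..<N}. {q i<..p i})"
proof -
  have "i < N" if "q i < j" "j \<le> p i" for i j
    using assms[of i] that by (cases "i < N") auto
  then show ?thesis by (auto simp: skew_diagram_def)
qed

lemma finite_skew_diagram: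
  assumes "\<And>i. i \<ge> N \<Longrightarrow> p i = 0"
  shows "finite (skew_diagram p q)"
  by (simp add: skew_diagram_eq_Sigma[of N p, OF assms])

lemma finite_SSYT: "finite (skew_diagram p q) \<Longrightarrow> finite (SSYT n p q)"
  by (rule finite_subset[of _ "skew_diagram p q \<rightarrow>\<^sub>E {1..n}"])
    (auto simp: SSYT_def intro: finite_PiE)

text \<open>
  Grouping the boxes of a tableau by their entry turns the product over boxes into the
  monomial of the weight.
\<close>

lemma skew_schur_eq_tableau_sum:
  assumes "finite (skew_diagram p q)"
  shows "skew_schur n p q = tableau_sum mvar n p q"
  unfolding skew_schur_def tableau_sum_def
proof (rule sum.cong[OF refl])
  fix T assume "T \<in> SSYT n p q"
  then have T: "T ` skew_diagram p q \<subseteq> {1..n}" by (auto simp: SSYT_def)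
  have "(\<Prod>b\<in>skew_diagram p q. mvar (T b) :: 'a mpoly) =
      (\<Prod>k\<in>{1..n}. \<Prod>b\<in>{b \<in> skew_diagram p q. T b = k}. mvar (T b))"
    using assms T by (subst prod.group) auto
  also have "\<dots> = mono_pow n (weight n p q T)"
    unfolding mono_pow_def by (intro prod.cong) (auto simp: weight_def)
  finally show "mono_pow n (weight n p q T) = (\<Prod>b\<in>skew_diagram p q. mvar (T b) :: 'a mpoly)" ..
qed

lemma SSYT_D:
  assumes "T \<in> SSYT n p q"
  shows "T \<in> extensional (skew_diagram p q)"
    and "\<And>b. b \<in> skew_diagram p q \<Longrightarrow> 1 \<le> T b \<and> T b \<le> n"
    and "\<And>i j j'. (i, j) \<in> skew_diagram p q \<Longrightarrow> (i, j') \<in> skew_diagram p q \<Longrightarrow> j \<le> j'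
        \<Longrightarrow> T (i, j) \<le> T (i, j')"
    and "\<And>i i' j. (i, j) \<in> skew_diagram p q \<Longrightarrow> (i', j) \<in> skew_diagram p q \<Longrightarrow> i < i'
        \<Longrightarrow> T (i, j) < T (i', j)"
  using assms by (fastforce simp: SSYT_def PiE_iff)+

text \<open>
  The shape of the boxes with entry at most \<open>n\<close> in a tableau with entries up to \<open>n + 1\<close>, together
  with \<open>q\<close>. Counting gives the row ends because these boxes form an initial segment of each row.
\<close>

definition inner_shape :: "nat \<Rightarrow> (nat \<Rightarrow> nat) \<Rightarrow> (nat \<Rightarrow> nat) \<Rightarrow> (nat \<times> nat \<Rightarrow> nat) \<Rightarrow> nat \<Rightarrow> nat" where
  "inner_shape n p q T i = q i + card {j. q i < j \<and> j \<le> p i \<and> T (i, j) \<le> n}"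

lemma inner_shape_iff:
  assumes T: "T \<in> SSYT (Suc n) p q" and ij: "(i, j) \<in> skew_diagram p q"
  shows "j \<le> inner_shape n p q T i \<longleftrightarrow> T (i, j) \<le> n"
proof -
  let ?S = "{j. q i < j \<and> j \<le> p i \<and> T (i, j) \<le> n}"
  have j: "q i < j" "j \<le> p i" using ij by (auto simp: skew_diagram_def)
  have fin: "finite ?S" by (rule finite_subset[of _ "{..p i}"]) auto
  show ?thesis
  proof
    assume "T (i, j) \<le> n"
    then have "{q i<..j} \<subseteq> ?S"
      using SSYT_D(3)[OF T, of i _ j] j by (fastforce simp: skew_diagram_def)
    from card_mono[OF fin this] show "j \<le> inner_shape n p q T i"
      using j by (simp add: inner_shape_def)
  next
    assume le: "j \<le> inner_shape n p q T i"
    show "T (i, j) \<le> n"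
    proof (rule ccontr)
      assume *: "\<not> T (i, j) \<le> n"
      have "?S \<subseteq> {q i<..<j}"
      proof
        fix k assume k: "k \<in> ?S"
        then have "\<not> j \<le> k"
          using * SSYT_D(3)[OF T ij, of k] by (auto simp: skew_diagram_def)
        then show "k \<in> {q i<..<j}" using k by simp
      qed
      from card_mono[OF _ this] show False using le j by (simp add: inner_shape_def)
    qed
  qed
qed

text \<open>
  The third bound is column strictness: a box with a box of the tableau below it cannot contain
  \<open>n + 1\<close>.
\<close>

lemma inner_shape_bounds:
  assumes T: "T \<in> SSYT (Suc n) p q" and p: "antimono p" and q: "antimono q"
    and qp: "\<And>i. q i \<le> p i"
  shows "q i \<le> inner_shape n p q T i" "inner_shape n p q T i \<le> p i"
    "p (Suc i) \<le> inner_shape n p q T i"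
proof -
  show "q i \<le> inner_shape n p q T i" by (simp add: inner_shape_def)
  have "card {j. q i < j \<and> j \<le> p i \<and> T (i, j) \<le> n} \<le> card {q i<..p i}"
    by (rule card_mono) auto
  then show "inner_shape n p q T i \<le> p i"
    using qp[of i] by (simp add: inner_shape_def)
  show "p (Suc i) \<le> inner_shape n p q T i"
  proof (cases "q i < p (Suc i)")
    case True
    have "p (Suc i) \<le> p i" "q (Suc i) \<le> q i"
      using antimonoD[OF p, of i "Suc i"] antimonoD[OF q, of i "Suc i"] by auto
    then have b: "(i, p (Suc i)) \<in> skew_diagram p q" "(Suc i, p (Suc i)) \<in> skew_diagram p q"
      using True by (auto simp: skew_diagram_def)
    have "T (i, p (Suc i)) \<le> n"
      using SSYT_D(4)[OF T b] SSYT_D(2)[OF T b(2)] by simp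
    then show ?thesis using inner_shape_iff[OF T b(1)] by simp
  qed (simp add: inner_shape_def)
qed

lemma antimono_horizontal_strip:
  assumes "\<nu> \<in> horizontal_strips N p"
  shows "antimono \<nu>"
  unfolding antimono_iff_le_Suc
proof
  fix i
  show "\<nu> (Suc i) \<le> \<nu> i"
    using assms by (cases "Suc i < N") (auto simp: horizontal_strips_def intro: order_trans[of _ "p (Suc i)"])
qed

lemma finite_horizontal_strips:
  assumes p: "antimono p"
  shows "finite (horizontal_strips N p)"
proof (rule finite_subset)
  show "horizontal_strips N p \<subseteq>
      {\<nu>. \<forall>i. (i \<in> {..<N} \<longrightarrow> \<nu> i \<in> {..p 0}) \<and> (i \<notin> {..<N} \<longrightarrow> \<nu> i = 0)}"
    using antimonoD[OF p, of 0] by (auto simp: horizontal_strips_def intro: order_trans)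
  show "finite {\<nu>. \<forall>i. (i \<in> {..<N} \<longrightarrow> \<nu> i \<in> {..p 0}) \<and> (i \<notin> {..<N} \<longrightarrow> \<nu> i = (0::nat))}"
    by (rule finite_set_of_finite_funs) auto
qed

definition erase_max :: "nat \<Rightarrow> (nat \<Rightarrow> nat) \<Rightarrow> (nat \<Rightarrow> nat) \<Rightarrow> (nat \<times> nat \<Rightarrow> nat) \<Rightarrow> nat \<times> nat \<Rightarrow> nat" where
  "erase_max n p q T = restrict T (skew_diagram (inner_shape n p q T) q)"

definition fill_max ::
  "nat \<Rightarrow> (nat \<Rightarrow> nat) \<Rightarrow> (nat \<Rightarrow> nat) \<Rightarrow> (nat \<Rightarrow> nat) \<Rightarrow> (nat \<times> nat \<Rightarrow> nat) \<Rightarrow> nat \<times> nat \<Rightarrow> nat" where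
  "fill_max n p q \<nu> T = (\<lambda>b\<in>skew_diagram p q. if b \<in> skew_diagram \<nu> q then T b else Suc n)"

lemma erase_max_SSYT:
  assumes T: "T \<in> SSYT (Suc n) p q" and p: "antimono p" and q: "antimono q"
    and qp: "\<And>i. q i \<le> p i"
  shows "erase_max n p q T \<in> SSYT n (inner_shape n p q T) q"
proof -
  let ?D = "skew_diagram (inner_shape n p q T) q"
  have sub: "?D \<subseteq> skew_diagram p q"
    using inner_shape_bounds(2)[OF T p q qp] by (auto simp: skew_diagram_def intro: order_trans)
  have "T b \<in> {1..n}" if "b \<in> ?D" for b
  proof (cases b)
    case (Pair i j)
    have "b \<in> skew_diagram p q" using sub that by auto
    then show ?thesis
      using inner_shape_iff[OF T, of i j] SSYT_D(2)[OF T, of b] that Pair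
      by (auto simp: skew_diagram_def)
  qed
  then show ?thesis
    unfolding SSYT_def erase_max_def
    using SSYT_D(3,4)[OF T, OF subsetD[OF sub] subsetD[OF sub]] by auto
qed

text \<open>
  The horizontal strip condition puts the new boxes into different columns, and each of them at
  the end of its row, so that filling them with the largest entry preserves both conditions.
\<close>

lemma fill_max_SSYT:
  assumes T: "T \<in> SSYT n \<nu> q" and \<nu>: "\<nu> \<in> horizontal_strips N p" and p0: "\<And>i. i \<ge> N \<Longrightarrow> p i = 0"
    and q: "antimono q" and p: "antimono p"
  shows "fill_max n p q \<nu> T \<in> SSYT (Suc n) p q"
proof -
  let ?D = "skew_diagram p q" and ?E = "skew_diagram \<nu> q"
  have in_E: "(i, j) \<in> ?E" if "(i, j) \<in> ?D" "(i', j) \<in> ?D" "i < i'" for i i' j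
  proof -
    have "i' < N" using that p0[of i'] by (cases "i' < N") (auto simp: skew_diagram_def)
    then have "p (Suc i) \<le> \<nu> i" using \<nu> that by (auto simp: horizontal_strips_def)
    moreover have "p i' \<le> p (Suc i)" using antimonoD[OF p, of "Suc i" i'] that by simp
    ultimately show ?thesis using that by (auto simp: skew_diagram_def)
  qed
  have E_left: "(i, j) \<in> ?E" if "(i, j) \<in> ?D" "(i, j') \<in> ?E" "j \<le> j'" for i j j'
    using that by (auto simp: skew_diagram_def)
  show ?thesis
    unfolding SSYT_def fill_max_def
    using SSYT_D(2-4)[OF T] in_E E_left
    by (auto simp: PiE_iff le_Suc_eq less_Suc_eq_le intro: le_SucI)
qed

text \<open>
  The branching rule. A tableau with entries up to \<open>n + 1\<close> is the same as a horizontal strip,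
  which holds the largest entry, and a tableau with entries up to \<open>n\<close> on the remaining shape.
\<close>

lemma tableau_sum_Suc:
  assumes p: "antimono p" "\<And>i. i \<ge> N \<Longrightarrow> p i = 0" and q: "antimono q" and qp: "\<And>i. q i \<le> p i"
  shows "tableau_sum x (Suc n) p q =
    (\<Sum>\<nu>\<in>{\<nu>\<in>horizontal_strips N p. \<forall>i. q i \<le> \<nu> i}.
       x (Suc n) ^ (\<Sum>i<N. p i - \<nu> i) * tableau_sum x n \<nu> q)"
proof -
  let ?H = "{\<nu>\<in>horizontal_strips N p. \<forall>i. q i \<le> \<nu> i}"
  have \<nu>0: "\<nu> i = 0" if "\<nu> \<in> horizontal_strips N p" "i \<ge> N" for \<nu> i
    using that by (auto simp: horizontal_strips_def)
  have \<nu>p: "\<nu> i \<le> p i" if "\<nu> \<in> horizontal_strips N p" for \<nu> i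
    using that by (cases "i < N") (auto simp: horizontal_strips_def)
  have finH: "finite ?H" using finite_horizontal_strips[OF p(1)] by simp
  have finD: "finite (skew_diagram \<nu> q)" if "\<nu> \<in> horizontal_strips N p" for \<nu>
    using finite_skew_diagram \<nu>0[OF that] by blast
  have sub: "skew_diagram \<nu> q \<subseteq> skew_diagram p q" if "\<nu> \<in> horizontal_strips N p" for \<nu>
    using \<nu>p[OF that] by (auto simp: skew_diagram_def intro: order_trans)
  have "tableau_sum x (Suc n) p q =
      (\<Sum>(\<nu>, T)\<in>(SIGMA \<nu>:?H. SSYT n \<nu> q).
        x (Suc n) ^ (\<Sum>i<N. p i - \<nu> i) * (\<Prod>b\<in>skew_diagram \<nu> q. x (T b)))"
    unfolding tableau_sum_def
  proof (rule sum.reindex_bij_witness[of _ "\<lambda>(\<nu>, T). fill_max n p q \<nu> T"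
        "\<lambda>T. (inner_shape n p q T, erase_max n p q T)"])
    fix T assume T: "T \<in> SSYT (Suc n) p q"
    let ?\<nu> = "inner_shape n p q T"
    note bd = inner_shape_bounds[OF T p(1) q qp]
    have \<nu>: "?\<nu> \<in> horizontal_strips N p"
      using bd bd(2)[of i for i] p(2) by (auto simp: horizontal_strips_def) (metis le_zero_eq)
    show "(?\<nu>, erase_max n p q T) \<in> (SIGMA \<nu>:?H. SSYT n \<nu> q)"
      using \<nu> bd(1) erase_max_SSYT[OF T p(1) q qp] by auto
    have big: "T b = Suc n" if "b \<in> skew_diagram p q" "b \<notin> skew_diagram ?\<nu> q" for b
    proof (cases b)
      case (Pair i j)
      then show ?thesis
        using that inner_shape_iff[OF T, of i j] SSYT_D(2)[OF T, of b]
        by (auto simp: skew_diagram_def)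
    qed
    show "(case (?\<nu>, erase_max n p q T) of (\<nu>, T) \<Rightarrow> fill_max n p q \<nu> T) = T"
      using big SSYT_D(1)[OF T]
      by (auto simp: fill_max_def erase_max_def fun_eq_iff extensional_def)
    have "(\<Prod>b\<in>skew_diagram p q. x (T b)) =
        (\<Prod>b\<in>skew_diagram p q - skew_diagram ?\<nu> q. x (T b)) * (\<Prod>b\<in>skew_diagram ?\<nu> q. x (T b))"
      using finite_skew_diagram[of N p q] p(2) sub[OF \<nu>] by (intro prod.subset_diff) auto
    also have "(\<Prod>b\<in>skew_diagram p q - skew_diagram ?\<nu> q. x (T b)) =
        x (Suc n) ^ card (skew_diagram p q - skew_diagram ?\<nu> q)"
      using big by (simp add: prod_constant[symmetric] del: prod_constant)
    also have "skew_diagram p q - skew_diagram ?\<nu> q = (SIGMA i:{..<N}. {?\<nu> i<..p i})"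
      using bd(1) skew_diagram_eq_Sigma[of N p q] p(2) by (auto simp: skew_diagram_def intro: le_less_trans[OF bd(1)])
    also have "card \<dots> = (\<Sum>i<N. p i - ?\<nu> i)" by simp
    finally show "(case (?\<nu>, erase_max n p q T) of (\<nu>, T) \<Rightarrow>
        x (Suc n) ^ (\<Sum>i<N. p i - \<nu> i) * (\<Prod>b\<in>skew_diagram \<nu> q. x (T b))) =
        (\<Prod>b\<in>skew_diagram p q. x (T b))"
      by (simp add: erase_max_def)
  next
    fix z assume "z \<in> (SIGMA \<nu>:?H. SSYT n \<nu> q)"
    then obtain \<nu> T where z: "z = (\<nu>, T)" and \<nu>: "\<nu> \<in> horizontal_strips N p" "\<And>i. q i \<le> \<nu> i"
      and T: "T \<in> SSYT n \<nu> q" by auto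
    show "(case z of (\<nu>, T) \<Rightarrow> fill_max n p q \<nu> T) \<in> SSYT (Suc n) p q"
      using fill_max_SSYT[OF T \<nu>(1) p(2) q p(1)] z by simp
    have "inner_shape n p q (fill_max n p q \<nu> T) i = \<nu> i" for i
    proof -
      have "{j. q i < j \<and> j \<le> p i \<and> fill_max n p q \<nu> T (i, j) \<le> n} = {q i<..\<nu> i}"
        using SSYT_D(2)[OF T] \<nu>p[OF \<nu>(1), of i]
        by (auto simp: fill_max_def skew_diagram_def split: if_splits)
      then show ?thesis using \<nu>(2)[of i] by (simp add: inner_shape_def)
    qed
    then have 1: "inner_shape n p q (fill_max n p q \<nu> T) = \<nu>" by auto
    have "erase_max n p q (fill_max n p q \<nu> T) = T"
      using SSYT_D(1)[OF T] sub[OF \<nu>(1)] contra_subsetD[OF sub[OF \<nu>(1)]]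
      unfolding erase_max_def 1 by (auto simp: fill_max_def fun_eq_iff extensional_def)
    with 1 show "(inner_shape n p q (case z of (\<nu>, T) \<Rightarrow> fill_max n p q \<nu> T),
        erase_max n p q (case z of (\<nu>, T) \<Rightarrow> fill_max n p q \<nu> T)) = z"
      by (simp add: z)
  qed
  also have "\<dots> = (\<Sum>\<nu>\<in>?H. x (Suc n) ^ (\<Sum>i<N. p i - \<nu> i) * tableau_sum x n \<nu> q)"
    using finH finite_SSYT finD
    by (subst sum.Sigma[symmetric]) (auto simp: tableau_sum_def sum_distrib_left)
  finally show ?thesis .
qed

text \<open>
  Both sides satisfy the same recursion in the number of variables. The recursion of the
  determinant also runs over shapes that do not contain \<open>q\<close>, but the determinants of these vanish.
\<close>

lemma jacobi_trudi_eq_tableau_sum: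
  assumes "antimono p" "\<And>i. i \<ge> N \<Longrightarrow> p i = 0" "antimono q" "\<And>i. q i \<le> p i"
  shows "tableau_sum x n p q = jacobi_trudi x n N p q"
  using assms
proof (induction n arbitrary: p)
  case 0
  show ?case
  proof (cases "p = q")
    case True
    then have "skew_diagram p q = {}" by (auto simp: skew_diagram_def)
    then have "SSYT 0 p q = {\<lambda>_. undefined}" by (auto simp: SSYT_def)
    then show ?thesis
      using True jacobi_trudi_0_same[OF 0(3)] \<open>skew_diagram p q = {}\<close> by (simp add: tableau_sum_def)
  next
    case False
    then obtain i where i: "q i < p i" using 0(4) by (metis ext le_neq_implies_less)
    then have "i < N" using 0(2)[of i] by (cases "i < N") auto
    moreover have "(i, p i) \<in> skew_diagram p q" using i by (simp add: skew_diagram_def)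
    then have "SSYT 0 p q = {}" by (auto simp: SSYT_def PiE_iff)
    ultimately show ?thesis
      using jacobi_trudi_0_distinct[of q p i N x] 0(4) i by (simp add: tableau_sum_def)
  qed
next
  case (Suc n)
  let ?H = "{\<nu>\<in>horizontal_strips N p. \<forall>i. q i \<le> \<nu> i}"
  let ?f = "\<lambda>\<nu>. x (Suc n) ^ (\<Sum>i<N. p i - \<nu> i)"
  have fin: "finite (horizontal_strips N p)"
    using finite_horizontal_strips Suc.prems(1) .
  have "tableau_sum x (Suc n) p q = (\<Sum>\<nu>\<in>?H. ?f \<nu> * tableau_sum x n \<nu> q)"
    by (rule tableau_sum_Suc) (use Suc.prems in auto)
  also have "\<dots> = (\<Sum>\<nu>\<in>?H. ?f \<nu> * jacobi_trudi x n N \<nu> q)"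
    using Suc.prems(3)
    by (intro sum.cong refl arg_cong2[of _ _ _ _ "(*)"] Suc.IH)
      (auto simp: antimono_horizontal_strip, auto simp: horizontal_strips_def)
  also have "\<dots> = (\<Sum>\<nu>\<in>horizontal_strips N p. ?f \<nu> * jacobi_trudi x n N \<nu> q)"
  proof (rule sum.mono_neutral_left[OF fin])
    show "\<forall>\<nu>\<in>horizontal_strips N p - ?H. ?f \<nu> * jacobi_trudi x n N \<nu> q = 0"
    proof
      fix \<nu> assume \<nu>: "\<nu> \<in> horizontal_strips N p - ?H"
      then obtain i where i: "\<nu> i < q i" by (auto simp: not_le)
      moreover have "i < N"
        using i Suc.prems(2,4)[of i] by (cases "i < N") auto
      ultimately show "?f \<nu> * jacobi_trudi x n N \<nu> q = 0"
        using jacobi_trudi_not_contained[of \<nu> q i N x n] \<nu> Suc.prems(3)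
          antimono_horizontal_strip[of \<nu> N p] by simp
    qed
  qed auto
  also have "\<dots> = jacobi_trudi x (Suc n) N p q"
    by (rule jacobi_trudi_Suc[symmetric]) (use Suc.prems in auto)
  finally show ?case .
qed

section \<open>Complete homogeneous polynomials as exponential sums\<close>

text \<open>
  The partial fraction decomposition of \<open>\<Prod>i. 1 / (1 - x\<^sub>i t)\<close>, with denominators cleared: for
  distinct \<open>x\<^sub>i\<close> it has simple poles only. Adding the variable \<open>y\<close> convolves with the powers of \<open>y\<close>,
  and \<open>(y - x\<^sub>i) (\<Sum>j\<le>m. x\<^sub>i\<^sup>j y\<^sup>m\<^sup>-\<^sup>j) = y\<^sup>m\<^sup>+\<^sup>1 - x\<^sub>i\<^sup>m\<^sup>+\<^sup>1\<close> keeps the shape of the sum.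
  At least one variable is required, since otherwise the sequence is \<open>1, 0, 0, \<dots>\<close>.
\<close>

lemma complete_hom_exponential_sum:
  fixes x :: "nat \<Rightarrow> 'b::idom"
  assumes "n > 0" "inj_on x {1..n}"
  shows "\<exists>d e. d \<noteq> 0 \<and> (\<forall>m. d * complete_hom x n (int m) = (\<Sum>i=1..n. e i * x i ^ m))"
  using assms
proof (induction n rule: nat_induct_non_zero)
  case 1
  have "complete_hom x 1 (int m) = x 1 ^ m" for m
    using complete_hom_Suc_conv[of x 0 m]
    by (simp add: complete_hom_0 if_distrib[of "\<lambda>c. c * _"] sum.delta cong: if_cong)
  then show ?case by (intro exI[of _ 1] exI[of _ "\<lambda>_. 1"]) simp
next
  case (Suc n)
  have "inj_on x {1..n}" using Suc.prems by (rule inj_on_subset) auto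
  then obtain d e where d: "d \<noteq> 0"
    and e: "\<And>m. d * complete_hom x n (int m) = (\<Sum>i=1..n. e i * x i ^ m)"
    using Suc.IH by blast
  define y where "y = x (Suc n)"
  define P where "P I = (\<Prod>j\<in>I. y - x j)" for I
  let ?e = "\<lambda>i. e i * P ({1..n} - {i})"
  have P: "P {1..n} = (y - x i) * P ({1..n} - {i})" if "i \<in> {1..n}" for i
    using that by (simp add: P_def prod.remove)
  have "P {1..n} \<noteq> 0"
    using inj_onD[OF Suc.prems, of "Suc n"] by (fastforce simp: P_def y_def)
  moreover have "P {1..n} * d * complete_hom x (Suc n) (int m) =
      (\<Sum>i=1..Suc n. (if i = Suc n then (\<Sum>j=1..n. ?e j) * y else - (?e i * x i)) * x i ^ m)" for m
  proof -
    have "P {1..n} * d * complete_hom x (Suc n) (int m) =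
        P {1..n} * (\<Sum>j\<le>m. (d * complete_hom x n (int j)) * y ^ (m - j))"
      by (simp add: complete_hom_Suc_conv sum_distrib_left mult_ac y_def)
    also have "\<dots> = (\<Sum>i=1..n. e i * (P {1..n} * (\<Sum>j\<le>m. x i ^ j * y ^ (m - j))))"
      unfolding e
      by (simp add: sum_distrib_left sum_distrib_right mult_ac) (rule sum.swap)
    also have "\<dots> = (\<Sum>i=1..n. ?e i * (y ^ Suc m - x i ^ Suc m))"
    proof (rule sum.cong[OF refl])
      fix i assume i: "i \<in> {1..n}"
      have "x i ^ Suc m - y ^ Suc m = (x i - y) * (\<Sum>j\<le>m. x i ^ j * y ^ (m - j))"
        by (subst diff_power_eq_sum) (simp add: lessThan_Suc_atMost)
      then have "(y - x i) * (\<Sum>j\<le>m. x i ^ j * y ^ (m - j)) = y ^ Suc m - x i ^ Suc m"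
        by (simp add: algebra_simps)
      moreover have "e i * (P {1..n} * (\<Sum>j\<le>m. x i ^ j * y ^ (m - j))) =
          ?e i * ((y - x i) * (\<Sum>j\<le>m. x i ^ j * y ^ (m - j)))"
        unfolding P[OF i] by (simp only: mult_ac)
      ultimately show "e i * (P {1..n} * (\<Sum>j\<le>m. x i ^ j * y ^ (m - j))) =
          ?e i * (y ^ Suc m - x i ^ Suc m)"
        by (simp only:)
    qed
    also have "\<dots> = (\<Sum>j=1..n. ?e j) * y * y ^ m + (\<Sum>i=1..n. - (?e i * x i) * x i ^ m)"
      unfolding sum_distrib_right sum.distrib[symmetric]
      by (intro sum.cong refl) (simp add: algebra_simps)
    finally show ?thesis by (simp add: y_def)
  qed
  ultimately show ?case using d
    by (intro exI[of _ "P {1..n} * d"] exI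
        [of _ "\<lambda>i. if i = Suc n then (\<Sum>j=1..n. ?e j) * y else - (?e i * x i)"]) auto
qed

section \<open>Exponential sums\<close>

text \<open>
  Sequences that are eventually \<open>\<Sum>w. C\<^sub>w (x\<^sup>w)\<^sup>k\<close> with coefficients \<open>C\<^sub>w\<close> that are rational
  functions independent of \<open>k\<close>. The polynomial \<open>d\<close> is a common denominator of the coefficients,
  so that everything stays inside the polynomial ring. A list, whose exponents may repeat,
  makes closure under sums and products a matter of concatenation.
\<close>

definition eventually_exp_sum :: "nat \<Rightarrow> (nat \<Rightarrow> 'a::idom mpoly) \<Rightarrow> bool" where
  "eventually_exp_sum n f \<longleftrightarrow> (\<exists>d cws. d \<noteq> 0 \<and>
     (\<forall>\<^sub>F k in sequentially. d * f k = (\<Sum>(c, w)\<leftarrow>cws. c * mono_pow n w ^ k)))"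

lemma eventually_exp_sumI:
  assumes "\<forall>\<^sub>F k in sequentially. d * f k = (\<Sum>(c, w)\<leftarrow>cws. c * mono_pow n w ^ k)" "d \<noteq> 0"
  shows "eventually_exp_sum n f"
  using assms unfolding eventually_exp_sum_def by blast

lemma mono_pow_zero: "mono_pow n (\<lambda>_. 0) = 1"
  by (simp add: mono_pow_def)

lemma mono_pow_add: "mono_pow n (\<lambda>i. v i + w i) = mono_pow n v * mono_pow n w"
  by (simp add: mono_pow_def power_add prod.distrib)

lemma eventually_exp_sum_const: "eventually_exp_sum n (\<lambda>_. c)"
  unfolding eventually_exp_sum_def
  by (intro exI[of _ 1] exI[of _ "[(c, \<lambda>_. 0)]"]) (simp add: mono_pow_zero)

lemma eventually_exp_sum_add:
  assumes "eventually_exp_sum n f" "eventually_exp_sum n g"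
  shows "eventually_exp_sum n (\<lambda>k. f k + g k)"
proof -
  obtain d cws where d: "d \<noteq> 0"
    "\<forall>\<^sub>F k in sequentially. d * f k = (\<Sum>(c, w)\<leftarrow>cws. c * mono_pow n w ^ k)"
    using assms(1) unfolding eventually_exp_sum_def by blast
  obtain d' cws' where d': "d' \<noteq> 0"
    "\<forall>\<^sub>F k in sequentially. d' * g k = (\<Sum>(c, w)\<leftarrow>cws'. c * mono_pow n w ^ k)"
    using assms(2) unfolding eventually_exp_sum_def by blast
  have scale: "(\<Sum>(c, w)\<leftarrow>map (\<lambda>(c, w). (b * c, w)) xs. c * mono_pow n w ^ k) =
      b * (\<Sum>(c, w)\<leftarrow>xs. c * mono_pow n w ^ k)" for b xs k
    by (induction xs) (auto simp: algebra_simps)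
  have "\<forall>\<^sub>F k in sequentially. (d * d') * (f k + g k) = (\<Sum>(c, w)\<leftarrow>
      map (\<lambda>(c, w). (d' * c, w)) cws @ map (\<lambda>(c, w). (d * c, w)) cws'. c * mono_pow n w ^ k)"
    using d(2) d'(2)
  proof eventually_elim
    case (elim k)
    show ?case unfolding map_append sum_list_append scale elim[symmetric] by (simp add: algebra_simps)
  qed
  then show ?thesis
    by (rule eventually_exp_sumI) (use d(1) d'(1) in simp)
qed

lemma eventually_exp_sum_mult:
  assumes "eventually_exp_sum n f" "eventually_exp_sum n g"
  shows "eventually_exp_sum n (\<lambda>k. f k * g k)"
proof -
  obtain d cws where d: "d \<noteq> 0"
    "\<forall>\<^sub>F k in sequentially. d * f k = (\<Sum>(c, w)\<leftarrow>cws. c * mono_pow n w ^ k)"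
    using assms(1) unfolding eventually_exp_sum_def by blast
  obtain d' cws' where d': "d' \<noteq> 0"
    "\<forall>\<^sub>F k in sequentially. d' * g k = (\<Sum>(c, w)\<leftarrow>cws'. c * mono_pow n w ^ k)"
    using assms(2) unfolding eventually_exp_sum_def by blast
  let ?mul = "\<lambda>cv ys. map (\<lambda>cw. (fst cv * fst cw, \<lambda>i. snd cv i + snd cw i)) ys"
  have single: "(\<Sum>(c, w)\<leftarrow>?mul cv ys. c * mono_pow n w ^ k) =
      fst cv * mono_pow n (snd cv) ^ k * (\<Sum>(c, w)\<leftarrow>ys. c * mono_pow n w ^ k)"
    for cv :: "'a mpoly \<times> (nat \<Rightarrow> nat)" and k and ys :: "('a mpoly \<times> (nat \<Rightarrow> nat)) list"
    by (induction ys) (auto simp: distrib_left mono_pow_add power_mult_distrib mult_ac)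
  have product: "(\<Sum>(c, w)\<leftarrow>concat (map (\<lambda>cv. ?mul cv ys) xs). c * mono_pow n w ^ k) =
      (\<Sum>(c, w)\<leftarrow>xs. c * mono_pow n w ^ k) * (\<Sum>(c, w)\<leftarrow>ys. c * mono_pow n w ^ k)"
    for xs ys :: "('a mpoly \<times> (nat \<Rightarrow> nat)) list" and k
  proof (induction xs)
    case (Cons cv xs)
    have "(\<Sum>(c, w)\<leftarrow>concat (map (\<lambda>cv. ?mul cv ys) (cv # xs)). c * mono_pow n w ^ k) =
        (\<Sum>(c, w)\<leftarrow>?mul cv ys. c * mono_pow n w ^ k) +
        (\<Sum>(c, w)\<leftarrow>concat (map (\<lambda>cv. ?mul cv ys) xs). c * mono_pow n w ^ k)"
      by simp
    also have "\<dots> = (\<Sum>(c, w)\<leftarrow>cv # xs. c * mono_pow n w ^ k) *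
        (\<Sum>(c, w)\<leftarrow>ys. c * mono_pow n w ^ k)"
      unfolding single Cons.IH by (simp add: case_prod_beta distrib_right)
    finally show ?case .
  qed simp
  have "\<forall>\<^sub>F k in sequentially. (d * d') * (f k * g k) = (\<Sum>(c, w)\<leftarrow>
      concat (map (\<lambda>cv. ?mul cv cws') cws). c * mono_pow n w ^ k)"
    using d(2) d'(2)
  proof eventually_elim
    case (elim k)
    show ?case unfolding product elim[symmetric] by (simp add: algebra_simps)
  qed
  then show ?thesis
    by (rule eventually_exp_sumI) (use d(1) d'(1) in simp)
qed

lemma eventually_exp_sum_sum:
  "(\<And>i. i \<in> I \<Longrightarrow> eventually_exp_sum n (f i)) \<Longrightarrow> eventually_exp_sum n (\<lambda>k. \<Sum>i\<in>I. f i k)"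
  by (induction I rule: infinite_finite_induct)
    (auto intro: eventually_exp_sum_const eventually_exp_sum_add)

lemma eventually_exp_sum_prod:
  "(\<And>i. i \<in> I \<Longrightarrow> eventually_exp_sum n (f i)) \<Longrightarrow> eventually_exp_sum n (\<lambda>k. \<Prod>i\<in>I. f i k)"
  by (induction I rule: infinite_finite_induct)
    (auto intro: eventually_exp_sum_const eventually_exp_sum_mult)

lemma eventually_exp_sum_cong:
  assumes "eventually_exp_sum n f" "\<forall>\<^sub>F k in sequentially. f k = g k"
  shows "eventually_exp_sum n g"
proof -
  obtain d cws where d: "d \<noteq> 0"
    "\<forall>\<^sub>F k in sequentially. d * f k = (\<Sum>(c, w)\<leftarrow>cws. c * mono_pow n w ^ k)"
    using assms(1) unfolding eventually_exp_sum_def by blast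
  have "\<forall>\<^sub>F k in sequentially. d * g k = (\<Sum>(c, w)\<leftarrow>cws. c * mono_pow n w ^ k)"
    using d(2) assms(2) by eventually_elim simp
  with d(1) show ?thesis unfolding eventually_exp_sum_def by blast
qed

lemma eventually_exp_sum_cancel:
  assumes "d \<noteq> 0" "eventually_exp_sum n (\<lambda>k. d * f k)"
  shows "eventually_exp_sum n f"
proof -
  obtain d' cws where d': "d' \<noteq> 0"
    "\<forall>\<^sub>F k in sequentially. d' * (d * f k) = (\<Sum>(c, w)\<leftarrow>cws. c * mono_pow n w ^ k)"
    using assms(2) unfolding eventually_exp_sum_def by blast
  show ?thesis
    by (rule eventually_exp_sumI[OF d'(2)[folded mult.assoc]]) (use assms(1) d'(1) in simp)
qed

lemma mono_pow_eq_single: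
  "mono_pow n w = (Poly_Mapping.single (\<Sum>k=1..n. Poly_Mapping.single k (w k)) 1 :: 'a::comm_semiring_1 mpoly)"
proof -
  have pow: "(mvar k :: 'a mpoly) ^ e = Poly_Mapping.single (Poly_Mapping.single k e) 1" for k e
    by (induction e) (auto simp: mvar_def mult_single single_add[symmetric])
  have "(\<Prod>k\<in>I. Poly_Mapping.single (f k) 1) = (Poly_Mapping.single (\<Sum>k\<in>I. f k) 1 :: 'a mpoly)"
    for I f
    by (induction I rule: infinite_finite_induct) (auto simp: mult_single)
  then show ?thesis by (simp add: mono_pow_def pow)
qed

lemma mvar_nonzero: "(mvar k :: 'a::comm_semiring_1 mpoly) \<noteq> 0"
  by (auto simp: mvar_def dest!: arg_cong[of _ _ Poly_Mapping.keys])

lemma inj_mvar: "inj (mvar :: nat \<Rightarrow> 'a::comm_ring_1 mpoly)"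
  by (auto simp: inj_def mvar_def dest!: arg_cong[of _ _ Poly_Mapping.keys])

text \<open>
  Depending on the sign of \<open>a\<close>, the sequence is eventually zero, constant, or in the range where
  the partial fraction decomposition applies. In the last case \<open>(x\<^sub>i\<^sup>a)\<^sup>k\<close> is a power of a monomial.
\<close>

lemma eventually_exp_sum_complete_hom:
  assumes "n > 0"
  shows "eventually_exp_sum n (\<lambda>k. complete_hom mvar n (int k * a + b) :: 'a::idom mpoly)"
proof (cases a "0::int" rule: linorder_cases)
  case less
  have "\<forall>\<^sub>F k in sequentially. 0 = (complete_hom mvar n (int k * a + b) :: 'a mpoly)"
    using eventually_gt_at_top[of "nat \<bar>b\<bar>"]
  proof eventually_elim
    case (elim k)
    have "int k * a \<le> - int k" using less mult_left_mono[of a "-1" "int k"] by simp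
    then have "int k * a + b < 0" using elim by linarith
    then show ?case by (simp add: complete_hom_neg)
  qed
  with eventually_exp_sum_const show ?thesis by (rule eventually_exp_sum_cong)
next
  case equal
  then show ?thesis by (simp add: eventually_exp_sum_const)
next
  case greater
  define K where "K = nat \<bar>b\<bar>"
  have nonneg: "int k * a + b \<ge> 0" if "k \<ge> K" for k
  proof -
    have "int k * a \<ge> int k" using greater mult_left_mono[of 1 a "int k"] by simp
    then show ?thesis using that unfolding K_def by linarith
  qed
  \<comment> \<open>For \<open>k \<ge> K\<close> the index is the natural number \<open>(k - K) a + b'\<close>. The offset \<open>b\<close> may be negative, and
    the factor \<open>x\<^sub>i\<^sup>K\<^sup>a\<close> in the denominator below makes up for that.\<close>
  define b' where "b' = nat (int K * a + b)"
  have arg: "int k * a + b = int ((k - K) * nat a + b')" if "k \<ge> K" for k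
  proof -
    have "int ((k - K) * nat a + b') = (int k - int K) * a + (int K * a + b)"
      using nonneg[of K] greater that by (simp add: b'_def of_nat_diff del: of_nat_mult) (simp add: of_nat_diff)
    then show ?thesis by (simp add: algebra_simps)
  qed
  obtain d e where d: "d \<noteq> 0"
    and e: "\<And>m. d * complete_hom mvar n (int m) = (\<Sum>i=1..n. e i * (mvar i :: 'a mpoly) ^ m)"
    using complete_hom_exponential_sum[OF assms inj_on_subset[OF inj_mvar subset_UNIV]] by blast
  have power: "eventually_exp_sum n (\<lambda>k. (mvar i :: 'a mpoly) ^ ((k - K) * nat a + b'))"
    if i: "i \<in> {1..n}" for i
  proof -
    let ?w = "\<lambda>j. if j = i then nat a else 0"
    have w: "mono_pow n ?w = (mvar i :: 'a mpoly) ^ nat a"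
      using i by (simp add: mono_pow_def if_distrib[of "\<lambda>e. _ ^ e"] prod.delta cong: if_cong)
    have "\<forall>\<^sub>F k in sequentially. (mvar i :: 'a mpoly) ^ (K * nat a) * mvar i ^ ((k - K) * nat a + b')
        = (\<Sum>(c, w)\<leftarrow>[(mvar i ^ b', ?w)]. c * mono_pow n w ^ k)"
      using eventually_ge_at_top[of K]
    proof eventually_elim
      case (elim k)
      have "K * nat a + ((k - K) * nat a + b') = b' + nat a * k"
        using elim add_mult_distrib[of K "k - K" "nat a"] by (simp add: mult.commute)
      then show ?case by (simp only: w power_add[symmetric] power_mult[symmetric] list.map
            sum_list.Cons sum_list.Nil prod.case add_0_right)
    qed
    then show ?thesis
      by (rule eventually_exp_sumI) (simp add: mvar_nonzero)
  qed
  have "eventually_exp_sum n (\<lambda>k. \<Sum>i=1..n. e i * (mvar i :: 'a mpoly) ^ ((k - K) * nat a + b'))"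
    by (intro eventually_exp_sum_sum eventually_exp_sum_mult eventually_exp_sum_const power)
  then have "eventually_exp_sum n (\<lambda>k. d * complete_hom mvar n (int k * a + b))"
    by (rule eventually_exp_sum_cong)
      (use eventually_ge_at_top[of K] in eventually_elim, simp only: arg e)
  with d show ?thesis by (rule eventually_exp_sum_cancel)
qed

text \<open>
  Combining the equations for \<open>k = r, r + 1, \<dots>\<close> with the coefficients of \<open>q\<close> gives
  \<open>\<Sum>w. c\<^sub>w y\<^sub>w\<^sup>r q(y\<^sub>w) = 0\<close> for every polynomial \<open>q\<close>. Choosing \<open>q\<close> with roots
  at all bases but one isolates a single coefficient.
\<close>

lemma exp_independent:
  fixes y :: "'i \<Rightarrow> 'b::idom"
  assumes fin: "finite A" and inj: "inj_on y A" and nz: "\<And>w. w \<in> A \<Longrightarrow> y w \<noteq> 0"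
    and zero: "\<And>k. k \<ge> r \<Longrightarrow> (\<Sum>w\<in>A. c w * y w ^ k) = 0" and v: "v \<in> A"
  shows "c v = 0"
proof -
  have q: "(\<Sum>w\<in>A. c w * y w ^ r * poly q (y w)) = 0" for q
  proof -
    have "(\<Sum>w\<in>A. c w * y w ^ r * poly q (y w)) =
        (\<Sum>i\<le>degree q. coeff q i * (\<Sum>w\<in>A. c w * y w ^ (r + i)))"
      by (simp add: poly_altdef sum_distrib_left power_add mult_ac) (rule sum.swap)
    then show ?thesis by (simp add: zero)
  qed
  define q where "q = (\<Prod>w\<in>A - {v}. [:- y w, 1:])"
  have "poly q (y w) = 0" if "w \<in> A - {v}" for w
    using fin that by (auto simp: q_def poly_prod intro!: prod_zero)
  then have "c v * y v ^ r * poly q (y v) = 0"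
    using q[of q] fin v by (simp add: sum.remove)
  moreover have "poly q (y v) \<noteq> 0"
    using fin inj v by (auto simp: q_def poly_prod inj_on_def)
  ultimately show ?thesis using nz[OF v] by simp
qed

section \<open>Permuting the variables\<close>

text \<open>
  For bijective \<open>\<sigma>\<close>, the ring automorphism that sends the variable \<open>i\<close> to \<open>\<sigma> i\<close>. The map on keys
  precomposes exponent functions, and precomposing twice cancels the contravariance.
\<close>

definition rename_vars :: "(nat \<Rightarrow> nat) \<Rightarrow> 'a::comm_semiring_1 mpoly \<Rightarrow> 'a mpoly" where
  "rename_vars \<sigma> = Poly_Mapping.map_key (Poly_Mapping.map_key \<sigma>)"

lemma bij_map_key:
  assumes \<sigma>: "bij \<sigma>"
  shows "bij (Poly_Mapping.map_key \<sigma> :: ('b \<Rightarrow>\<^sub>0 'c::zero) \<Rightarrow> _)"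
proof (rule o_bij)
  have inj: "inj \<sigma>" "inj (inv_into UNIV \<sigma>)" using \<sigma> by (auto simp: bij_is_inj bij_imp_bij_inv)
  show "Poly_Mapping.map_key (inv_into UNIV \<sigma>) \<circ> Poly_Mapping.map_key \<sigma> = (id :: ('b \<Rightarrow>\<^sub>0 'c) \<Rightarrow> _)"
    using map_key_compose[OF inj(2,1)] \<sigma>
    by (auto simp: fun_eq_iff bij_is_surj surj_f_inv_f o_def map_key_id)
  show "Poly_Mapping.map_key \<sigma> \<circ> Poly_Mapping.map_key (inv_into UNIV \<sigma>) = (id :: ('a \<Rightarrow>\<^sub>0 'c) \<Rightarrow> _)"
    using map_key_compose[OF inj] inj(1)
    by (auto simp: fun_eq_iff o_def map_key_id)
qed

context
  fixes \<sigma> :: "nat \<Rightarrow> nat"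
  assumes \<sigma>: "bij \<sigma>"
begin

lemma inj_map_key_monomial: "inj (Poly_Mapping.map_key \<sigma> :: (nat \<Rightarrow>\<^sub>0 nat) \<Rightarrow> _)"
  by (rule bij_is_inj[OF bij_map_key[OF \<sigma>]])

lemma rename_vars_zero: "rename_vars \<sigma> 0 = 0"
  unfolding rename_vars_def by (rule map_key_zero[OF inj_map_key_monomial])

lemma rename_vars_add: "rename_vars \<sigma> (f + g) = rename_vars \<sigma> f + rename_vars \<sigma> g"
  unfolding rename_vars_def by (rule map_key_plus[OF inj_map_key_monomial])

lemma rename_vars_single:
  "rename_vars \<sigma> (Poly_Mapping.single (Poly_Mapping.map_key \<sigma> e) c) = Poly_Mapping.single e c"
  unfolding rename_vars_def by (rule map_key_single[OF inj_map_key_monomial])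

lemma rename_vars_sum: "rename_vars \<sigma> (\<Sum>i\<in>I. f i) = (\<Sum>i\<in>I. rename_vars \<sigma> (f i))"
  by (induction I rule: infinite_finite_induct) (auto simp: rename_vars_zero rename_vars_add)

lemma rename_vars_mult: "rename_vars \<sigma> (f * g) = rename_vars \<sigma> f * rename_vars \<sigma> g"
proof -
  have monomials: "rename_vars \<sigma> (Poly_Mapping.single a c * Poly_Mapping.single b d) =
      rename_vars \<sigma> (Poly_Mapping.single a c) * rename_vars \<sigma> (Poly_Mapping.single b d)"
    for a b :: "nat \<Rightarrow>\<^sub>0 nat" and c d :: 'a
  proof -
    \<comment> \<open>The value of \<open>rename_vars\<close> is known on monomials that are images of the bijection on exponents;
      every monomial is one.\<close>
    obtain a' b' where ab: "a = Poly_Mapping.map_key \<sigma> a'" "b = Poly_Mapping.map_key \<sigma> b'"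
      using bij_is_surj[OF bij_map_key[OF \<sigma>]] by (metis surjD)
    have "a + b = Poly_Mapping.map_key \<sigma> (a' + b')"
      using map_key_plus[OF bij_is_inj[OF \<sigma>], of a' b'] ab by simp
    then show ?thesis by (simp add: mult_single rename_vars_single) (simp add: ab mult_single rename_vars_single)
  qed
  have expand: "h = (\<Sum>e\<in>Poly_Mapping.keys h. Poly_Mapping.single e (Poly_Mapping.lookup h e))"
    for h :: "'a mpoly"
    by (rule poly_mapping_eqI) (auto simp: lookup_sum lookup_single when_def in_keys_iff)
  let ?s = "\<lambda>h e. Poly_Mapping.single e (Poly_Mapping.lookup h e)"
  have "rename_vars \<sigma> ((\<Sum>a\<in>Poly_Mapping.keys f. ?s f a) * (\<Sum>b\<in>Poly_Mapping.keys g. ?s g b)) =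
      rename_vars \<sigma> (\<Sum>a\<in>Poly_Mapping.keys f. ?s f a) * rename_vars \<sigma> (\<Sum>b\<in>Poly_Mapping.keys g. ?s g b)"
    by (simp add: sum_product rename_vars_sum monomials)
  then show ?thesis by (simp only: expand[symmetric])
qed

lemma rename_vars_mvar: "rename_vars \<sigma> (mvar i) = mvar (\<sigma> i)"
  unfolding mvar_def using rename_vars_single map_key_single[OF bij_is_inj[OF \<sigma>], of i 1] by metis

lemma rename_vars_one: "rename_vars \<sigma> 1 = 1"
  using rename_vars_single[of 0 1] by (simp add: map_key_zero[OF bij_is_inj[OF \<sigma>]])

lemma rename_vars_prod: "rename_vars \<sigma> (\<Prod>i\<in>I. f i) = (\<Prod>i\<in>I. rename_vars \<sigma> (f i))"
  by (induction I rule: infinite_finite_induct) (auto simp: rename_vars_one rename_vars_mult)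

lemma rename_vars_power: "rename_vars \<sigma> (f ^ k) = rename_vars \<sigma> f ^ k"
  by (induction k) (auto simp: rename_vars_one rename_vars_mult)

lemma rename_vars_eq_0_iff: "rename_vars \<sigma> f = 0 \<longleftrightarrow> f = 0"
proof
  assume 0: "rename_vars \<sigma> f = 0"
  have "Poly_Mapping.lookup f e = 0" for e
  proof -
    obtain e' where e: "e = Poly_Mapping.map_key \<sigma> e'"
      using bij_is_surj[OF bij_map_key[OF \<sigma>]] by (metis surjD)
    have "Poly_Mapping.lookup f e = Poly_Mapping.lookup (rename_vars \<sigma> f) e'"
      unfolding e rename_vars_def by (simp add: map_key.rep_eq[OF inj_map_key_monomial])
    then show ?thesis using 0 by simp
  qed
  then show "f = 0" by (intro poly_mapping_eqI) simp
qed (simp add: rename_vars_zero)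

end

lemma rename_vars_mono_pow:
  assumes \<sigma>: "\<sigma> permutes {1..n}"
  shows "rename_vars (inv_into UNIV \<sigma>) (mono_pow n w) = mono_pow n (w \<circ> \<sigma>)"
proof -
  have b: "bij (inv_into UNIV \<sigma>)" using permutes_bij[OF permutes_inv[OF \<sigma>]] .
  have "rename_vars (inv_into UNIV \<sigma>) (mono_pow n w) = (\<Prod>k\<in>{1..n}. mvar (inv_into UNIV \<sigma> k) ^ w k)"
    by (simp add: mono_pow_def rename_vars_prod[OF b] rename_vars_power[OF b] rename_vars_mvar[OF b])
  also have "\<dots> = (\<Prod>k\<in>{1..n}. mvar (inv_into UNIV \<sigma> (\<sigma> k)) ^ w (\<sigma> k))"
    using prod.permute[OF \<sigma>, of "\<lambda>k. mvar (inv_into UNIV \<sigma> k) ^ w k"] by (simp add: o_def)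
  also have "\<dots> = mono_pow n (w \<circ> \<sigma>)"
    by (simp add: mono_pow_def permutes_inverses(2)[OF \<sigma>])
  finally show ?thesis .
qed

text \<open>
  Skew Schur polynomials are symmetric, because the entries of the Jacobi-Trudi matrix are.
\<close>

lemma rename_vars_tableau_sum:
  assumes "antimono p" "\<And>i. i \<ge> N \<Longrightarrow> p i = 0" "antimono q" "\<And>i. q i \<le> p i"
    and \<sigma>: "\<sigma> permutes {1..n}"
  shows "rename_vars \<sigma> (tableau_sum mvar n p q) = (tableau_sum mvar n p q :: 'a::comm_ring_1 mpoly)"
proof -
  note b = permutes_bij[OF \<sigma>]
  have "rename_vars \<sigma> (tableau_sum mvar n p q) = (tableau_sum (mvar \<circ> \<sigma>) n p q :: 'a mpoly)"
    by (simp add: tableau_sum_def rename_vars_sum[OF b] rename_vars_prod[OF b] rename_vars_mvar[OF b])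
  also have "\<dots> = tableau_sum mvar n p q"
  proof -
    have "tableau_sum x n p q = jacobi_trudi x n N p q" for x :: "nat \<Rightarrow> 'a mpoly"
      by (rule jacobi_trudi_eq_tableau_sum) (use assms in auto)
    then show ?thesis by (simp add: jacobi_trudi_permute[OF \<sigma>])
  qed
  finally show ?thesis .
qed

section \<open>The exponents and the minimal characteristic polynomial\<close>

lemma mono_pow_nonzero: "mono_pow n w \<noteq> (0 :: 'a::idom mpoly)"
  by (simp add: mono_pow_def mvar_nonzero)

lemma inj_on_mono_pow: "inj_on (mono_pow n :: _ \<Rightarrow> 'a::comm_semiring_1 mpoly) (nat_vectors n)"
proof (rule inj_onI)
  fix v w assume vw: "v \<in> nat_vectors n" "w \<in> nat_vectors n"
    and eq: "(mono_pow n v :: 'a mpoly) = mono_pow n w"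
  let ?e = "\<lambda>w. \<Sum>k=1..n. Poly_Mapping.single k (w k)"
  have e: "?e v = ?e w"
    using eq unfolding mono_pow_eq_single
    by (auto dest!: arg_cong[of _ _ Poly_Mapping.keys])
  have look: "Poly_Mapping.lookup (?e w) i = w i" if "i \<in> {1..n}" for w :: "nat \<Rightarrow> nat" and i
    using that by (simp add: lookup_sum lookup_single when_def)
  have "v i = w i" if "i \<in> {1..n}" for i
    using look[OF that, of v] look[OF that, of w] e by simp
  then show "v = w" by (intro PiE_ext[OF vw]) auto
qed

text \<open>
  Collecting equal exponents and dropping zero coefficients gives the set \<open>W\<close> of the exponents
  that really occur.
\<close>

lemma eventually_exp_sum_collect:
  fixes a :: "nat \<Rightarrow> 'a::idom mpoly"
  assumes "eventually_exp_sum n a"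
  shows "\<exists>d W c R. d \<noteq> 0 \<and> finite W \<and> W \<subseteq> nat_vectors n \<and> (\<forall>w\<in>W. c w \<noteq> 0) \<and>
    (\<forall>k\<ge>R. d * a k = (\<Sum>w\<in>W. c w * mono_pow n w ^ k))"
proof -
  obtain d cws R where d: "d \<noteq> 0"
    and a: "\<And>k. k \<ge> R \<Longrightarrow> d * a k = (\<Sum>(c, w)\<leftarrow>cws. c * mono_pow n w ^ k)"
    using assms unfolding eventually_exp_sum_def eventually_sequentially by blast
  let ?ext = "\<lambda>w. restrict w {1..n}"
  define V where "V = (\<lambda>(c, w). ?ext w) ` set cws"
  define coef where "coef xs v = (\<Sum>(c, w)\<leftarrow>xs. if ?ext w = v then c else 0)"
    for xs :: "('a mpoly \<times> (nat \<Rightarrow> nat)) list" and v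
  have finV: "finite V" by (simp add: V_def)
  have restr: "mono_pow n (?ext w) = (mono_pow n w :: 'a mpoly)" for w
    by (simp add: mono_pow_def)
  have collect: "(\<Sum>(c, w)\<leftarrow>xs. c * mono_pow n w ^ k) = (\<Sum>v\<in>V. coef xs v * mono_pow n v ^ k)"
    if "set xs \<subseteq> set cws" for xs k
    using that
  proof (induction xs)
    case (Cons cw xs)
    obtain c w where cw: "cw = (c, w)" by force
    have "?ext w \<in> V" using Cons.prems by (force simp: V_def cw)
    have "(\<Sum>v\<in>V. coef (cw # xs) v * mono_pow n v ^ k) =
        (\<Sum>v\<in>V. (if v = ?ext w then c * mono_pow n w ^ k else 0) + coef xs v * mono_pow n v ^ k)"
      using restr[of w] by (intro sum.cong refl) (auto simp: coef_def cw distrib_right)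
    also have "\<dots> = c * mono_pow n w ^ k + (\<Sum>v\<in>V. coef xs v * mono_pow n v ^ k)"
      using finV \<open>?ext w \<in> V\<close> by (simp add: sum.distrib)
    finally show ?case using Cons by (simp add: cw)
  qed (simp add: coef_def)
  have "d * a k = (\<Sum>v\<in>{v\<in>V. coef cws v \<noteq> 0}. coef cws v * mono_pow n v ^ k)" if "k \<ge> R" for k
  proof -
    have "d * a k = (\<Sum>v\<in>V. coef cws v * mono_pow n v ^ k)"
      using a[OF that] collect by simp
    also have "\<dots> = (\<Sum>v\<in>{v\<in>V. coef cws v \<noteq> 0}. coef cws v * mono_pow n v ^ k)"
      using finV by (intro sum.mono_neutral_right) auto
    finally show ?thesis .
  qed
  then show ?thesis
    using d finV by (intro exI[of _ d] exI[of _ "{v\<in>V. coef cws v \<noteq> 0}"] exI[of _ "coef cws"] exI[of _ R])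
      (auto simp: V_def)
qed

text \<open>
  Permuting the variables fixes \<open>a k\<close> and turns the coefficient of \<open>(x\<^sup>w)\<^sup>k\<close> into a coefficient of
  \<open>(x\<^sup>w\<^sup>\<circ>\<^sup>\<sigma>)\<^sup>k\<close>. By linear independence the two expressions for \<open>a k\<close> have the same exponents. The
  permutation also changes the denominator \<open>d\<close>, so the comparison is made after multiplication
  with both \<open>d\<close> and its image.
\<close>

lemma exponents_permutation_invariant:
  fixes a :: "nat \<Rightarrow> 'a::idom mpoly"
  assumes d: "d \<noteq> 0" and W: "finite W" "W \<subseteq> nat_vectors n" and c: "\<And>w. w \<in> W \<Longrightarrow> c w \<noteq> 0"
    and a: "\<And>k. k \<ge> R \<Longrightarrow> d * a k = (\<Sum>w\<in>W. c w * mono_pow n w ^ k)"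
    and sym: "\<And>k \<tau>. k \<ge> R \<Longrightarrow> \<tau> permutes {1..n} \<Longrightarrow> rename_vars \<tau> (a k) = a k"
    and \<sigma>: "\<sigma> permutes {1..n}" and w: "w \<in> W"
  shows "w \<circ> \<sigma> \<in> W"
proof (rule ccontr)
  assume notin: "w \<circ> \<sigma> \<notin> W"
  let ?\<tau> = "inv_into UNIV \<sigma>"
  let ?S = "(\<lambda>v. v \<circ> \<sigma>) ` W"
  have \<tau>: "?\<tau> permutes {1..n}" by (rule permutes_inv[OF \<sigma>])
  note b = permutes_bij[OF \<tau>]
  have comp: "v \<circ> \<sigma> \<circ> ?\<tau> = v" for v :: "nat \<Rightarrow> nat"
    by (simp add: fun_eq_iff permutes_inverses(1)[OF \<sigma>])
  have inj: "inj_on (\<lambda>v. v \<circ> \<sigma>) W"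
    by (rule inj_on_inverseI[of _ "\<lambda>v. v \<circ> ?\<tau>"]) (rule comp)
  have S: "?S \<subseteq> nat_vectors n"
    using W(2) permutes_in_image[OF \<sigma>] by (fastforce simp: PiE_iff extensional_def)
  \<comment> \<open>The coefficients of the difference of the two expressions for \<open>\<tau>(d) d a\<^sub>k\<close>.\<close>
  let ?c = "\<lambda>v. (if v \<in> W then rename_vars ?\<tau> d * c v else 0)
      - (if v \<in> ?S then d * rename_vars ?\<tau> (c (v \<circ> ?\<tau>)) else 0)"
  have "?c (w \<circ> \<sigma>) = 0"
  proof (rule exp_independent[where A = "W \<union> ?S" and y = "mono_pow n" and r = R and c = ?c])
    show "finite (W \<union> ?S)" "w \<circ> \<sigma> \<in> W \<union> ?S" using W w by auto
    show "inj_on (mono_pow n :: _ \<Rightarrow> 'a mpoly) (W \<union> ?S)"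
      by (rule inj_on_subset[OF inj_on_mono_pow]) (use W S in auto)
    show "mono_pow n v \<noteq> (0 :: 'a mpoly)" for v by (rule mono_pow_nonzero)
    fix k assume k: "k \<ge> R"
    have "rename_vars ?\<tau> d * a k = rename_vars ?\<tau> (d * a k)"
      by (simp add: rename_vars_mult[OF b] sym[OF k \<tau>])
    also have "\<dots> = (\<Sum>v\<in>W. rename_vars ?\<tau> (c v) * mono_pow n (v \<circ> \<sigma>) ^ k)"
      unfolding a[OF k]
      by (simp add: rename_vars_sum[OF b] rename_vars_mult[OF b] rename_vars_power[OF b]
          rename_vars_mono_pow[OF \<sigma>])
    also have "\<dots> = (\<Sum>v\<in>?S. rename_vars ?\<tau> (c (v \<circ> ?\<tau>)) * mono_pow n v ^ k)"
      by (simp add: sum.reindex[OF inj] comp)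
    finally have 2: "d * (rename_vars ?\<tau> d * a k) =
        (\<Sum>v\<in>?S. d * rename_vars ?\<tau> (c (v \<circ> ?\<tau>)) * mono_pow n v ^ k)"
      by (simp add: sum_distrib_left mult.assoc)
    have 1: "rename_vars ?\<tau> d * (d * a k) = (\<Sum>v\<in>W. rename_vars ?\<tau> d * c v * mono_pow n v ^ k)"
      unfolding a[OF k] by (simp add: sum_distrib_left mult.assoc)
    have "(\<Sum>v\<in>W \<union> ?S. ?c v * mono_pow n v ^ k) =
        (\<Sum>v\<in>W \<union> ?S. if v \<in> W then rename_vars ?\<tau> d * c v * mono_pow n v ^ k else 0) -
        (\<Sum>v\<in>W \<union> ?S. if v \<in> ?S then d * rename_vars ?\<tau> (c (v \<circ> ?\<tau>)) * mono_pow n v ^ k else 0)"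
      unfolding sum_subtractf[symmetric] by (intro sum.cong refl) (simp add: left_diff_distrib)
    also have "\<dots> = (\<Sum>v\<in>W. rename_vars ?\<tau> d * c v * mono_pow n v ^ k) -
        (\<Sum>v\<in>?S. d * rename_vars ?\<tau> (c (v \<circ> ?\<tau>)) * mono_pow n v ^ k)"
      using W(1) by (simp add: sum.inter_restrict[symmetric] Int_absorb1 Int_absorb2)
    also have "\<dots> = 0"
      unfolding 1[symmetric] 2[symmetric] by (simp add: mult_ac)
    finally show "(\<Sum>v\<in>W \<union> ?S. ?c v * mono_pow n v ^ k) = 0" .
  qed
  then have "d * rename_vars ?\<tau> (c w) = 0" using notin w by (simp add: comp)
  then show False using d c[OF w] by (simp add: rename_vars_eq_0_iff[OF b])
qed

text \<open>
  Applying a polynomial \<open>\<psi>\<close> in the shift operator to the sequence multiplies the coefficient of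
  \<open>y\<^sub>w\<^sup>k\<close> by \<open>\<psi>(y\<^sub>w)\<close>. By linear independence, \<open>\<psi>\<close> annihilates the sequence if and only if it
  vanishes at all \<open>y\<^sub>w\<close>, and then its degree is at least the number of these.
\<close>

lemma min_char_poly_of_exp_sum:
  fixes a :: "nat \<Rightarrow> 'b::field"
  assumes W: "finite W" and inj: "inj_on y W" and y: "\<And>w. w \<in> W \<Longrightarrow> y w \<noteq> 0"
    and c: "\<And>w. w \<in> W \<Longrightarrow> c w \<noteq> 0"
    and a: "\<And>k. k \<ge> r \<Longrightarrow> a k = (\<Sum>w\<in>W. c w * y w ^ k)"
    and K: "\<And>i. coeff (\<Prod>w\<in>W. [:- y w, 1:]) i \<in> K"
  shows "min_char_poly_of K r a (\<Prod>w\<in>W. [:- y w, 1:])"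
proof -
  let ?\<chi> = "\<Prod>w\<in>W. [:- y w, 1:]"
  have apply_poly: "(\<Sum>i\<le>degree \<psi>. coeff \<psi> i * a (k + i)) = (\<Sum>w\<in>W. c w * poly \<psi> (y w) * y w ^ k)"
    if "k \<ge> r" for \<psi> k
  proof -
    have "(\<Sum>i\<le>degree \<psi>. coeff \<psi> i * a (k + i)) =
        (\<Sum>i\<le>degree \<psi>. \<Sum>w\<in>W. coeff \<psi> i * (c w * y w ^ (k + i)))"
      using a that by (simp add: sum_distrib_left)
    also have "\<dots> = (\<Sum>w\<in>W. \<Sum>i\<le>degree \<psi>. coeff \<psi> i * (c w * y w ^ (k + i)))"
      by (rule sum.swap)
    also have "\<dots> = (\<Sum>w\<in>W. c w * poly \<psi> (y w) * y w ^ k)"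
      by (simp add: poly_altdef sum_distrib_left sum_distrib_right power_add mult_ac)
    finally show ?thesis .
  qed
  have roots: "poly ?\<chi> (y w) = 0" if "w \<in> W" for w
    using W that by (auto simp: poly_prod intro!: prod_zero)
  have "char_poly_of K r a ?\<chi>"
    unfolding char_poly_of_def
    using K roots by (simp add: apply_poly lead_coeff_prod)
  moreover have "degree ?\<chi> \<le> degree \<psi>" if \<psi>: "char_poly_of K r a \<psi>" for \<psi>
  proof -
    have "c w * poly \<psi> (y w) = 0" if "w \<in> W" for w
    proof (rule exp_independent[OF W inj y _ that])
      fix k assume "k \<ge> r"
      with \<psi> show "(\<Sum>w\<in>W. c w * poly \<psi> (y w) * y w ^ k) = 0"
        by (simp add: apply_poly[symmetric] char_poly_of_def)
    qed
    then have sub: "y ` W \<subseteq> {z. poly \<psi> z = 0}" using c by auto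
    have "\<psi> \<noteq> 0" using \<psi> by (auto simp: char_poly_of_def)
    have "degree ?\<chi> = card (y ` W)"
      by (simp add: degree_prod_sum_eq card_image[OF inj])
    also have "\<dots> \<le> card {z. poly \<psi> z = 0}"
      by (rule card_mono[OF poly_roots_finite[OF \<open>\<psi> \<noteq> 0\<close>] sub])
    also have "\<dots> \<le> degree \<psi>" by (rule card_poly_roots_bound[OF \<open>\<psi> \<noteq> 0\<close>])
    finally show ?thesis .
  qed
  ultimately show ?thesis by (simp add: min_char_poly_of_def)
qed

lemma mpolys_in_diff: "f \<in> mpolys_in n \<Longrightarrow> g \<in> mpolys_in n \<Longrightarrow> f - g \<in> mpolys_in n"
  for f g :: "'a::comm_ring_1 mpoly"
  using keys_diff[of f g] by (auto simp: mpolys_in_def)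

lemma mpolys_in_mult: "f \<in> mpolys_in n \<Longrightarrow> g \<in> mpolys_in n \<Longrightarrow> f * g \<in> mpolys_in n"
  unfolding mpolys_in_def
proof (intro CollectI ballI)
  assume fg: "f \<in> {f. \<forall>e\<in>Poly_Mapping.keys f. Poly_Mapping.keys e \<subseteq> {1..n}}"
    "g \<in> {f. \<forall>e\<in>Poly_Mapping.keys f. Poly_Mapping.keys e \<subseteq> {1..n}}"
  fix e assume "e \<in> Poly_Mapping.keys (f * g)"
  then obtain a b where "e = a + b" "a \<in> Poly_Mapping.keys f" "b \<in> Poly_Mapping.keys g"
    using keys_mult[of f g] by blast
  then show "Poly_Mapping.keys e \<subseteq> {1..n}"
    using fg keys_add[of a b] by blast
qed

lemma mpolys_in_consts: "0 \<in> mpolys_in n" "1 \<in> mpolys_in n"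
  by (auto simp: mpolys_in_def)

lemma mono_pow_in_mpolys_in: "mono_pow n w \<in> mpolys_in n"
proof -
  have "mvar k ^ e \<in> mpolys_in n" if "k \<in> {1..n}" for k e
    using that by (induction e) (auto intro!: mpolys_in_mult mpolys_in_consts, auto simp: mpolys_in_def mvar_def)
  then have prod: "(\<Prod>k\<in>I. mvar k ^ w k) \<in> mpolys_in n" if "I \<subseteq> {1..n}" for I
    using that by (induction I rule: infinite_finite_induct) (auto intro!: mpolys_in_mult mpolys_in_consts)
  show ?thesis unfolding mono_pow_def by (rule prod) simp
qed

lemma coeff_prod_ratfuns_in:
  fixes W :: "(nat \<Rightarrow> nat) set"
  shows "coeff (\<Prod>w\<in>W. [:- to_fract (mono_pow n w), 1:]) i \<in> (ratfuns_in n :: 'a::field mpoly fract set)"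
proof -
  have "\<exists>f\<in>mpolys_in n. coeff (\<Prod>w\<in>W. [:- to_fract (mono_pow n w :: 'a mpoly), 1:]) i = to_fract f"
  proof (induction W arbitrary: i rule: infinite_finite_induct)
    case (insert w W)
    let ?P = "\<Prod>w\<in>W. [:- to_fract (mono_pow n w :: 'a mpoly), 1:]"
    obtain f where f: "f \<in> mpolys_in n" "coeff ?P i = to_fract f" using insert.IH by blast
    obtain g where g: "g \<in> mpolys_in n" "(case i of 0 \<Rightarrow> 0 | Suc j \<Rightarrow> coeff ?P j) = to_fract g"
    proof (cases i)
      case 0
      then show ?thesis by (intro that[of 0]) (auto intro: mpolys_in_consts)
    next
      case (Suc j)
      then show ?thesis using that insert.IH[of j] by auto
    qed
    have eq: "coeff ([:- to_fract (mono_pow n w), 1:] * ?P) i = to_fract (g - mono_pow n w * f)"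
      using f(2) g(2) by (simp add: coeff_pCons)
    show ?case
      unfolding prod.insert[OF insert.hyps]
    proof (rule bexI[of _ "g - mono_pow n w * f"])
      show "g - mono_pow n w * f \<in> mpolys_in n"
        by (intro mpolys_in_diff mpolys_in_mult mono_pow_in_mpolys_in f(1) g(1))
    qed (rule eq)
  next
    case empty
    show ?case
      by (rule bexI[of _ "if i = 0 then 1 else 0"]) (simp_all add: mpolys_in_consts)
  next
    case (infinite W)
    then show ?case
      by (intro bexI[of _ "if i = 0 then 1 else 0"]) (simp_all add: mpolys_in_consts)
  qed
  then obtain f where "f \<in> mpolys_in n"
    "coeff (\<Prod>w\<in>W. [:- to_fract (mono_pow n w :: 'a mpoly), 1:]) i = Fract f 1"
    unfolding to_fract_def by blast
  then show ?thesis
    unfolding ratfuns_in_def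
    by (intro CollectI exI[of _ f] exI[of _ 1]) (simp add: mpolys_in_consts)
qed

text \<open>
  In the stretched shape every index of the Jacobi-Trudi matrix is an affine function of \<open>k\<close>
  with slope \<open>\<mu> i - \<nu> j\<close>.
\<close>

lemma eventually_exp_sum_jacobi_trudi:
  assumes "n > 0"
  shows "eventually_exp_sum n (\<lambda>k. jacobi_trudi mvar n N
    (\<lambda>i. \<kappa> i + k * \<mu> i) (\<lambda>i. \<rho> i + k * \<nu> i) :: 'a::idom mpoly)"
proof -
  have "(int (\<kappa> i + k * \<mu> i) - int i) - (int (\<rho> j + k * \<nu> j) - int j) =
      int k * (int (\<mu> i) - int (\<nu> j)) + ((int (\<kappa> i) - int i) - (int (\<rho> j) - int j))" for i j k
    by (simp add: algebra_simps)
  then show ?thesis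
    unfolding jacobi_trudi_Leibniz
    by (simp only:) (intro eventually_exp_sum_sum eventually_exp_sum_mult eventually_exp_sum_const
        eventually_exp_sum_prod eventually_exp_sum_complete_hom assms)
qed

lemma partition_eq_0:
  assumes "is_partition p" "partition_length p \<le> n" "i \<ge> n"
  shows "p i = 0"
proof (rule ccontr)
  assume "p i \<noteq> 0"
  then have "{..i} \<subseteq> {i. p i > 0}"
    using assms(1) by (auto simp: is_partition_def dest!: antimonoD[of p])
  then have "card {..i} \<le> card {i. p i > 0}"
    using assms(1) by (intro card_mono) (auto simp: is_partition_def)
  then show False using assms(2,3) by (simp add: partition_length_def)
qed

theorem corollary15:
  fixes n m :: nat and \<kappa> \<rho> \<mu> \<nu> :: "nat \<Rightarrow> nat"
  assumes "n > 0"
    and "is_partition \<kappa>" "is_partition \<rho>" "is_partition \<mu>" "is_partition \<nu>"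
    and "partition_length \<kappa> \<le> n" "partition_length \<rho> \<le> n"
      "partition_length \<mu> \<le> n" "partition_length \<nu> \<le> n"
    and "\<forall>i. \<mu> i \<ge> \<nu> i"
    and "m > 0" "\<forall>i. int m * (int (\<mu> i) - int (\<nu> i)) \<ge> int (\<rho> i) - int (\<kappa> i)"
  shows "\<exists>R. \<forall>r\<ge>R. \<exists>W. W \<subseteq> nat_vectors n \<and> finite W \<and>
    (\<forall>w\<in>W. \<forall>\<sigma>. \<sigma> permutes {1..n} \<longrightarrow> w \<circ> \<sigma> \<in> W) \<and>
    min_char_poly_of (ratfuns_in n) r
      (\<lambda>k. to_fract (skew_schur n (\<lambda>i. \<kappa> i + k * \<mu> i) (\<lambda>i. \<rho> i + k * \<nu> i)
              :: 'a::field_char_0 mpoly))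
      (\<Prod>w\<in>W. [:- to_fract (mono_pow n w), 1:])"
proof -
  define p where "p k = (\<lambda>i. \<kappa> i + k * \<mu> i)" for k
  define q where "q k = (\<lambda>i. \<rho> i + k * \<nu> i)" for k
  define a where "a k = (skew_schur n (p k) (q k) :: 'a mpoly)" for k
  have anti: "antimono (p k)" "antimono (q k)" for k
    using assms(2-5) unfolding is_partition_def p_def q_def
    by (auto intro!: antimonoI add_mono mult_left_mono dest: antimonoD)
  have zero: "p k i = 0" if "i \<ge> n" for k i
    using partition_eq_0[OF assms(2,6) that] partition_eq_0[OF assms(4,8) that] by (simp add: p_def)
  \<comment> \<open>Containment of the stretched shapes is only guaranteed from \<open>k = m\<close> on.\<close>
  have le: "q k i \<le> p k i" if "k \<ge> m" for k i
  proof -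
    have "int m * (int (\<mu> i) - int (\<nu> i)) \<le> int k * (int (\<mu> i) - int (\<nu> i))"
      using that assms(10) by (intro mult_right_mono) auto
    then have "int (q k i) \<le> int (p k i)"
      using assms(12)[rule_format, of i] by (simp add: p_def q_def algebra_simps)
    then show ?thesis by simp
  qed
  have schur: "a k = tableau_sum mvar n (p k) (q k)" for k
    unfolding a_def by (rule skew_schur_eq_tableau_sum[OF finite_skew_diagram[OF zero]])
  have "eventually_exp_sum n (\<lambda>k. jacobi_trudi mvar n n (p k) (q k) :: 'a mpoly)"
    unfolding p_def q_def by (rule eventually_exp_sum_jacobi_trudi[OF assms(1)])
  moreover have "\<forall>\<^sub>F k in sequentially. jacobi_trudi mvar n n (p k) (q k) = a k"
    using eventually_ge_at_top[of m]
    by eventually_elim (simp add: schur jacobi_trudi_eq_tableau_sum[OF anti(1) zero anti(2) le])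
  ultimately have "eventually_exp_sum n a" by (rule eventually_exp_sum_cong)
  from eventually_exp_sum_collect[OF this] obtain d W c R where d: "d \<noteq> 0"
    and W: "finite W" "W \<subseteq> nat_vectors n" and c: "\<forall>w\<in>W. c w \<noteq> 0"
    and a: "\<forall>k\<ge>R. d * a k = (\<Sum>w\<in>W. c w * mono_pow n w ^ k)"
    by (elim exE conjE)
  have sym: "rename_vars \<tau> (a k) = a k" if "k \<ge> max m R" "\<tau> permutes {1..n}" for k \<tau>
    unfolding schur using that by (intro rename_vars_tableau_sum[OF anti(1) zero anti(2) le]) auto
  have perm: "w \<circ> \<sigma> \<in> W" if "w \<in> W" "\<sigma> permutes {1..n}" for w \<sigma>
    by (rule exponents_permutation_invariant[where R = "max m R", OF d W _ _ sym that(2,1)]) (use a c in auto)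
  have power: "to_fract (mono_pow n w ^ k) = to_fract (mono_pow n w :: 'a mpoly) ^ k" for w k
    by (induction k) auto
  have min: "min_char_poly_of (ratfuns_in n) r (\<lambda>k. to_fract (a k))
      (\<Prod>w\<in>W. [:- to_fract (mono_pow n w), 1:])" if "r \<ge> R" for r
  proof (rule min_char_poly_of_exp_sum[OF W(1), where c = "\<lambda>w. to_fract (c w) / to_fract d"])
    show "inj_on (\<lambda>w. to_fract (mono_pow n w :: 'a mpoly)) W"
      using inj_on_subset[OF inj_on_mono_pow W(2)] by (auto simp: inj_on_def)
    fix k assume "k \<ge> r"
    then have "to_fract (d * a k) = to_fract (\<Sum>w\<in>W. c w * mono_pow n w ^ k)"
      using that a by simp
    then show "to_fract (a k) = (\<Sum>w\<in>W. to_fract (c w) / to_fract d * to_fract (mono_pow n w) ^ k)"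
      using d by (simp add: power sum_divide_distrib[symmetric] field_simps)
  qed (use d c in \<open>auto simp: mono_pow_nonzero coeff_prod_ratfuns_in\<close>)
  show ?thesis
  proof (intro exI[of _ R] allI impI exI[of _ W] conjI ballI)
    fix r assume "r \<ge> R"
    then show "min_char_poly_of (ratfuns_in n) r
        (\<lambda>k. to_fract (skew_schur n (\<lambda>i. \<kappa> i + k * \<mu> i) (\<lambda>i. \<rho> i + k * \<nu> i) :: 'a mpoly))
        (\<Prod>w\<in>W. [:- to_fract (mono_pow n w), 1:])"
      by (rule min[unfolded a_def p_def q_def])
  qed (use W perm in auto)
qed

end
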